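(* Let $A, B \subseteq \mathbb{R}$ be finite sets, and let $f$ and $g$ each be either a (strictly) convex or a (strictly) concave function (defined on sets containing $A$ and $B$ respectively). Then $$|A+B|^{38}\,|f(A) + g(B)|^{38} \gtrsim (|A||B|)^{49}.$$
   Context: For finite sets $X,Y\subseteq\mathbb{R}$, $X+Y=\{x+y: x\in X, y\in Y\}$, and $f(A)=\{f(a):a\in A\}$. All convex/concave functions are strictly convex/concave. The notation $X\gtrsim Y$ means $X \ge c\,Y/(\log N)^{C}$ for absolute constants $c,C>0$, where $N$ is the size of the sets involved (logarithmic factors are suppressed). $f$ and $g$ may independently be convex or concave (e.g. $f$ convex and $g$ concave). *)

theory Defs
  imports "HOL-Analysis.Analysis" "HOL-Library.Set_Algebras"
begin

text \<open>
  Strict convexity and concavity for a real function on an arbitrary domain: the usual strict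
  inequality is imposed at those intermediate points that lie in the domain. On a convex domain the
  membership condition is automatic (see \<open>strictly_convex_on_convex_iff\<close>), which gives the standard
  notion. Unlike the non-strict library notion \<^const>\<open>convex_on\<close>, the domain is not required to
  be convex.
\<close>

definition strictly_convex_on :: "real set \<Rightarrow> (real \<Rightarrow> real) \<Rightarrow> bool"
  where "strictly_convex_on S f \<longleftrightarrow>
    (\<forall>x\<in>S. \<forall>y\<in>S. \<forall>t. x \<noteq> y \<and> 0 < t \<and> t < 1 \<and> (1 - t) * x + t * y \<in> S \<longrightarrow>
      f ((1 - t) * x + t * y) < (1 - t) * f x + t * f y)"

definition strictly_concave_on :: "real set \<Rightarrow> (real \<Rightarrow> real) \<Rightarrow> bool"
  where "strictly_concave_on S f \<longleftrightarrow>
    (\<forall>x\<in>S. \<forall>y\<in>S. \<forall>t. x \<noteq> y \<and> 0 < t \<and> t < 1 \<and> (1 - t) * x + t * y \<in> S \<longrightarrow>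
      f ((1 - t) * x + t * y) > (1 - t) * f x + t * f y)"

lemma strictly_convex_on_convex_iff:
  assumes "convex S"
  shows "strictly_convex_on S f \<longleftrightarrow>
    (\<forall>x\<in>S. \<forall>y\<in>S. \<forall>t. x \<noteq> y \<and> 0 < t \<and> t < 1 \<longrightarrow>
      f ((1 - t) * x + t * y) < (1 - t) * f x + t * f y)"
proof -
  have "(1 - t) * x + t * y \<in> S" if "x \<in> S" "y \<in> S" "0 < t" "t < 1" for x y t
    using convexD[OF assms that(1,2), of "1 - t" t] that by simp
  then show ?thesis
    unfolding strictly_convex_on_def by blast
qed

lemma strictly_concave_on_iff_neg:
  "strictly_concave_on S f \<longleftrightarrow> strictly_convex_on S (\<lambda>x. - f x)"
  unfolding strictly_concave_on_def strictly_convex_on_def by (simp add: algebra_simps)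

text \<open>
  The quantity \<open>N\<close> in \<open>(log N)\<^sup>C\<close>: the larger of the two cardinalities, but at least 2, so that
  \<open>log N\<close> is positive also when both sets have at most one element.
\<close>

definition size_param :: "'a set \<Rightarrow> 'b set \<Rightarrow> nat"
  where "size_param A B = max 2 (max (card A) (card B))"

end

theory Submission
  imports Defs
begin

text \<open>
  For a strictly convex \<open>f\<close>, two translates of the graph of \<open>f\<close> share at most one point, so a
  Szemeredi--Trotter bound holds for them; for translates along Cartesian products it follows from an
  elementary count, because a monotone piece of the graph crosses few cells of a grid. Applied to the
  popular differences of \<open>f(A)\<close>, it shows that the third moment of the representation function of
  \<open>a - x\<close> is small on a large subset of \<open>A\<close> whenever the cubic energy \<open>E\<^sub>3(f(A))\<close> is large, and the
  roles of \<open>A\<close> and \<open>f(A)\<close> can be exchanged. On the other hand, counting pairs \<open>(a + b, a' + b)\<close> of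
  popular sums whose difference is a popular difference of \<open>A\<close> bounds \<open>|A + B|\<close> from below in terms of
  these third moments and cubic energies. Multiplying the bounds for \<open>(A, B)\<close> and \<open>(f(A), g(B))\<close>,
  the unknown energies cancel.

  All losses are powers of an integer \<open>L \<ge> 8\<close> of order \<open>log N\<close>, which also absorbs absolute constants.
\<close>

section \<open>Incidences with translates of a monotone curve\<close>

text \<open>Neither cubic energy can be bounded alone: for an arithmetic progression
  \<open>A\<close>, E_3(A) has the maximal order |A|^4. So the energies stay as unknowns and only
  products across the curve are estimated. Up to logarithms, if the third moments of A and B against
  every X are at most k_A |X|^2 and k_B |X|^2, counting sums gives (|A||B|)^57 \<le> |A+B|^38 (k_A
  k_B)^3 (E_3(A) E_3(B))^8. The curve gives k_A E_3(f(A)) \<le> |A|^5, k_f(A) E_3(A) \<le> |A|^5 and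
  E_3(A) E_3(f(A)) \<le> |A|^7. In the product of the sumset bounds for (A, B) and (f(A), g(B)) the
  factor belonging to A consists of the first two to the power 3 and the third to the power 5: 15 +
  15 + 35 = 65, and 2 * 57 - 65 = 49. The obstacle is that exceptional elements must be discarded
  repeatedly, and an energy may collapse on a subset. Hence the work with sets whose energy survives
  every small deletion.\<close>

definition rank_in :: "real set \<Rightarrow> real \<Rightarrow> nat"
  where "rank_in Z z = card {w \<in> Z. w < z}"

lemma rank_in_less:
  assumes "finite Z" "z \<in> Z" "z < z'"
  shows "rank_in Z z < rank_in Z z'"
  unfolding rank_in_def using assms by (intro psubset_card_mono) auto

lemma rank_in_less_card:
  assumes "finite Z" "z \<in> Z"
  shows "rank_in Z z < card Z"
  unfolding rank_in_def using assms by (intro psubset_card_mono) auto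

lemma rank_in_inject:
  assumes "finite Z" "z \<in> Z" "z' \<in> Z" "rank_in Z z = rank_in Z z'"
  shows "z = z'"
  using rank_in_less[OF assms(1,2), of z'] rank_in_less[OF assms(1,3), of z] assms(4)
  by (metis less_irrefl linorder_neqE_linordered_idom)

lemma diff_less_of_div_eq:
  fixes a b m :: nat
  assumes "a div m = b div m" "m \<ge> 1"
  shows "b - a < m"
proof -
  have "b div m * m + a mod m = a" using div_mult_mod_eq[of a m] assms(1) by simp
  moreover have "b div m * m + b mod m = b" by (rule div_mult_mod_eq)
  moreover have "b mod m < m" using assms(2) by simp
  ultimately show ?thesis by linarith
qed

text \<open>
  The set \<open>H\<close> parametrises the curve \<open>{(u h, v h) | h \<in> H}\<close>: it is an increasing curve, and two of its
  translates share at most one point.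
\<close>

definition increasing_curve :: "(real \<Rightarrow> real) \<Rightarrow> (real \<Rightarrow> real) \<Rightarrow> real set \<Rightarrow> bool"
  where "increasing_curve u v H \<longleftrightarrow>
    inj_on u H \<and> inj_on v H \<and>
    (\<forall>a\<in>H. \<forall>b\<in>H. u a < u b \<longleftrightarrow> v a < v b) \<and>
    (\<forall>a\<in>H. \<forall>b\<in>H. \<forall>a'\<in>H. \<forall>b'\<in>H. a \<noteq> b \<longrightarrow> u a - u b = u a' - u b' \<longrightarrow>
       v a - v b = v a' - v b' \<longrightarrow> a = a')"

lemma increasing_curve_subset:
  "increasing_curve u v H \<Longrightarrow> H' \<subseteq> H \<Longrightarrow> increasing_curve u v H'"
  unfolding increasing_curve_def by (meson inj_on_subset subset_iff)

lemma increasing_curve_differences: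
  assumes "increasing_curve u v H" "a \<in> H" "b \<in> H" "a' \<in> H" "b' \<in> H" "a \<noteq> b"
    "u a - u b = u a' - u b'" "v a - v b = v a' - v b'"
  shows "a = a'"
  using assms unfolding increasing_curve_def by metis

lemma increasing_curve_less:
  assumes "increasing_curve u v H" "a \<in> H" "b \<in> H"
  shows "u a < u b \<longleftrightarrow> v a < v b"
  using assms unfolding increasing_curve_def by blast

lemma increasing_curve_sym: "increasing_curve u v H \<Longrightarrow> increasing_curve v u H"
  unfolding increasing_curve_def by meson

text \<open>
  Cut \<open>Z \<times> Y\<close> into blocks of \<open>m \<times> n\<close> consecutive elements. A translate of the curve meets few blocks
  because it is increasing; an incidence that is not the last one of its translate in its block is
  determined by itself and a later incidence in the same block.
\<close>

lemma incidence_bound: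
  fixes u v :: "real \<Rightarrow> real"
  assumes fin: "finite X" "finite C" "finite Z" "finite Y" "finite H"
    and curve: "increasing_curve u v H" and mn: "m \<ge> 1" "n \<ge> 1"
  shows "card {(x, c, h). x \<in> X \<and> c \<in> C \<and> h \<in> H \<and> u h - x \<in> Z \<and> v h - c \<in> Y}
    \<le> card X * card C * (card Z div m + card Y div n + 1) + card Z * (m - 1) * (card Y * (n - 1))"
proof -
  define I where "I = {(x, c, h). x \<in> X \<and> c \<in> C \<and> h \<in> H \<and> u h - x \<in> Z \<and> v h - c \<in> Y}"
  define rz where "rz = (\<lambda>x h. rank_in Z (u h - x))"
  define ry where "ry = (\<lambda>c h. rank_in Y (v h - c))"
  \<comment> \<open>Along one translate both block indices are nondecreasing, so equality of their
    sum forces equality of both: \<open>s\<close> identifies the block within a translate, yet takes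
    few values.\<close>
  define s where "s = (\<lambda>x c h. rz x h div m + ry c h div n)"
  define La where "La = {(x, c, h). (x, c, h) \<in> I \<and> \<not> (\<exists>h'. (x, c, h') \<in> I \<and> u h < u h' \<and> s x c h = s x c h')}"
  have finI: "finite I"
    by (rule finite_subset[of _ "X \<times> C \<times> H"]) (use fin in \<open>auto simp: I_def\<close>)
  have LaI: "La \<subseteq> I" by (auto simp: La_def)
  have injLa: "inj_on (\<lambda>(x, c, h). (x, c, s x c h)) La"
  proof -
    have "h = h'" if "(x, c, h) \<in> La" "(x, c, h') \<in> La" "s x c h = s x c h'" for x c h h'
    proof -
      have "\<not> u h < u h'" "\<not> u h' < u h" "h \<in> H" "h' \<in> H"
        using that by (auto simp: La_def I_def)
      moreover have "inj_on u H" using curve by (simp add: increasing_curve_def)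
      ultimately show "h = h'" by (metis inj_onD linorder_neqE_linordered_idom)
    qed
    then show ?thesis by (auto simp: inj_on_def)
  qed
  have "s x c h \<le> card Z div m + card Y div n" if "(x, c, h) \<in> I" for x c h
  proof -
    have "rz x h \<le> card Z" "ry c h \<le> card Y"
      using that fin rank_in_less_card unfolding rz_def ry_def I_def
      by (auto simp: less_imp_le)
    then show ?thesis unfolding s_def by (intro add_mono div_le_mono)
  qed
  then have "(\<lambda>(x, c, h). (x, c, s x c h)) ` La \<subseteq> X \<times> C \<times> {..card Z div m + card Y div n}"
    using LaI by (fastforce simp: I_def)
  then have cardLa: "card La \<le> card X * card C * (card Z div m + card Y div n + 1)"
    using card_inj_on_le[OF injLa, of "X \<times> C \<times> {..card Z div m + card Y div n}"] fin
    by (simp add: card_cartesian_product algebra_simps)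
  define nx where "nx = (\<lambda>(x, c, h). SOME h'. (x, c, h') \<in> I \<and> u h < u h' \<and> s x c h = s x c h')"
  have nx: "(x, c, nx (x, c, h)) \<in> I \<and> u h < u (nx (x, c, h)) \<and> s x c h = s x c (nx (x, c, h))"
    if "(x, c, h) \<in> I - La" for x c h
    using someI_ex[of "\<lambda>h'. (x, c, h') \<in> I \<and> u h < u h' \<and> s x c h = s x c h'"] that
    unfolding nx_def La_def by auto
  have block: "rz x h < rz x h' \<and> rz x h' - rz x h - 1 < m - 1 \<and> ry c h < ry c h' \<and> ry c h' - ry c h - 1 < n - 1"
    if "(x, c, h) \<in> I" "(x, c, h') \<in> I" "u h < u h'" "s x c h = s x c h'" for x c h h'
  proof -
    have v: "v h < v h'" using that increasing_curve_less[OF curve, of h h'] by (auto simp: I_def)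
    have l1: "rz x h < rz x h'" unfolding rz_def
      using that fin by (intro rank_in_less) (auto simp: I_def)
    have l2: "ry c h < ry c h'" unfolding ry_def
      using that v fin by (intro rank_in_less) (auto simp: I_def)
    have "rz x h div m \<le> rz x h' div m" "ry c h div n \<le> ry c h' div n"
      using l1 l2 by (auto intro: div_le_mono)
    then have e: "rz x h div m = rz x h' div m" "ry c h div n = ry c h' div n"
      using that(4) unfolding s_def by linarith+
    have "rz x h' - rz x h < m" "ry c h' - ry c h < n"
      using e mn by (auto intro: diff_less_of_div_eq)
    then show ?thesis using l1 l2 by linarith
  qed
  \<comment> \<open>Two incidences in one block have rank gaps between 1 and m - 1 (or n - 1).
    Storing the gap minus 1 leaves exactly m - 1 and n - 1 values, so the count vanishes for blocks
    of length 1.\<close>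
  define \<Phi> where "\<Phi> = (\<lambda>(x, c, h). ((u h - x, rz x (nx (x, c, h)) - rz x h - 1),
      (v h - c, ry c (nx (x, c, h)) - ry c h - 1)))"
  have inj\<Phi>: "inj_on \<Phi> (I - La)"
  proof (rule inj_onI)
    fix p p2 assume p: "p \<in> I - La" "p2 \<in> I - La" "\<Phi> p = \<Phi> p2"
    obtain x c h x2 c2 h2 where pp: "p = (x, c, h)" "p2 = (x2, c2, h2)" by (metis prod_cases3)
    have a: "(x, c, h) \<in> I" "(x, c, h) \<notin> La" "(x2, c2, h2) \<in> I" "(x2, c2, h2) \<notin> La"
      and eq: "\<Phi> (x, c, h) = \<Phi> (x2, c2, h2)"
      using p pp by auto
    define k where "k = nx (x, c, h)"
    define k2 where "k2 = nx (x2, c2, h2)"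
    have k: "(x, c, k) \<in> I" "u h < u k" "s x c h = s x c k"
      using nx[of x c h] a unfolding k_def by auto
    have k2: "(x2, c2, k2) \<in> I" "u h2 < u k2" "s x2 c2 h2 = s x2 c2 k2"
      using nx[of x2 c2 h2] a unfolding k2_def by auto
    note b = block[OF a(1) k] and b2 = block[OF a(3) k2]
    have e: "u h - x = u h2 - x2" "v h - c = v h2 - c2"
      "rz x k - rz x h - 1 = rz x2 k2 - rz x2 h2 - 1" "ry c k - ry c h - 1 = ry c2 k2 - ry c2 h2 - 1"
      using eq unfolding \<Phi>_def k_def k2_def by auto
    have "rz x h = rz x2 h2" "ry c h = ry c2 h2" using e(1,2) unfolding rz_def ry_def by auto
    then have "rz x k = rz x2 k2" "ry c k = ry c2 k2" using e b b2 by linarith+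
    moreover have "u k - x \<in> Z" "u k2 - x2 \<in> Z" "v k - c \<in> Y" "v k2 - c2 \<in> Y"
      using k(1) k2(1) by (auto simp: I_def)
    ultimately have "u k - x = u k2 - x2" "v k - c = v k2 - c2"
      using rank_in_inject fin unfolding rz_def ry_def by blast+
    \<comment> \<open>Equal pairs of grid points give equal chords of the curve. A nonzero chord
      determines its starting point, and then \<open>x\<close> and \<open>c\<close> follow.\<close>
    then have "u h - u k = u h2 - u k2" "v h - v k = v h2 - v k2"
      using e(1,2) by linarith+
    moreover have "h \<in> H" "k \<in> H" "h2 \<in> H" "k2 \<in> H" "h \<noteq> k"
      using a(1,3) k k2 by (auto simp: I_def)
    ultimately have "h = h2" using increasing_curve_differences[OF curve, of h k h2 k2] by simp
    then show "p = p2" using e pp by auto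
  qed
  have "\<Phi> ` (I - La) \<subseteq> (Z \<times> {..<m - 1}) \<times> (Y \<times> {..<n - 1})"
  proof (rule image_subsetI, clarify)
    fix x c h assume a: "(x, c, h) \<in> I" "(x, c, h) \<notin> La"
    then have k: "(x, c, nx (x, c, h)) \<in> I" "u h < u (nx (x, c, h))" "s x c h = s x c (nx (x, c, h))"
      using nx[of x c h] by auto
    show "\<Phi> (x, c, h) \<in> (Z \<times> {..<m - 1}) \<times> (Y \<times> {..<n - 1})"
      using block[OF a(1) k] a(1) by (auto simp: \<Phi>_def I_def)
  qed
  then have "card (I - La) \<le> card Z * (m - 1) * (card Y * (n - 1))"
    using card_inj_on_le[OF inj\<Phi>, of "(Z \<times> {..<m - 1}) \<times> (Y \<times> {..<n - 1})"] fin
    by (simp add: card_cartesian_product)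
  moreover have "card I = card La + card (I - La)"
    using LaI finI by (metis card_Diff_subset card_mono finite_subset le_add_diff_inverse)
  ultimately show ?thesis using cardLa unfolding I_def by linarith
qed

text \<open>The representation function of z = a - x with a \<in> A and x \<in> X; \<open>a\<close>
  alone determines the representation.\<close>

definition rep_count :: "real set \<Rightarrow> real set \<Rightarrow> real \<Rightarrow> nat"
  where "rep_count A X z = card {a \<in> A. a - z \<in> X}"

text \<open>The ceiling of a / K, except for the value 1 at a = 0: it serves as a block length,
  which must be positive.\<close>

definition ceil_div :: "nat \<Rightarrow> nat \<Rightarrow> nat"
  where "ceil_div a K = (if a = 0 then 1 else (a - 1) div K + 1)"

lemma ceil_div:
  assumes "K \<ge> 1"
  shows "ceil_div a K \<ge> 1" "a div ceil_div a K \<le> K" "(ceil_div a K - 1) * K \<le> a"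
proof -
  have "a < ((a - 1) div K + 1) * (K + 1)" if "a > 0"
  proof -
    have "a - 1 < ((a - 1) div K + 1) * K"
      using assms by (metis add.commute dividend_less_div_times mult.commute
          mult_Suc_right plus_1_eq_Suc less_le_trans zero_less_one)
    then show ?thesis using that by (simp add: algebra_simps)
  qed
  then show "a div ceil_div a K \<le> K"
    unfolding ceil_div_def
    by (auto simp: less_Suc_eq_le[symmetric] div_less_iff_less_mult mult.commute)
  show "ceil_div a K \<ge> 1" "(ceil_div a K - 1) * K \<le> a"
    unfolding ceil_div_def by (auto intro: order.trans[OF div_times_less_eq_dividend])
qed

text \<open>Each z has \<open>\<tau>\<close> representations u h - x, and each such \<open>h\<close>
  has \<open>\<rho>\<close> partners \<open>c\<close>, so the grid Z x Y carries at least card Z *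
  \<tau> * \<rho> incidences. Balancing the block size in \<open>incidence_bound\<close> yields the
  Szemeredi--Trotter shape.\<close>

lemma rich_translates_bound:
  fixes u v :: "real \<Rightarrow> real"
  assumes fin: "finite X" "finite C" "finite Z" "finite Y" "finite H"
    and curve: "increasing_curve u v H" and HC: "card H \<le> card C"
    and rho: "\<And>h. h \<in> H \<Longrightarrow> \<rho> \<le> card {c \<in> C. v h - c \<in> Y}"
    and tau: "\<And>z. z \<in> Z \<Longrightarrow> \<tau> \<le> rep_count (u ` H) X z"
  shows "card Z * (\<tau> * \<rho>) ^ 3 \<le> 512 * (card X * card C * card Y) ^ 2"
proof (cases "card Z * (\<tau> * \<rho>) = 0")
  case True
  then show ?thesis by auto
next
  case False
  define t where "t = card Z"
  define T where "T = \<tau> * \<rho>"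
  define P where "P = card X * card C"
  define q where "q = card Y"
  have pos: "t > 0" "T > 0" "\<tau> > 0" "\<rho> > 0" using False by (auto simp: t_def T_def)
  have injv: "inj_on u H" using curve by (auto simp: increasing_curve_def)
  have rdu: "rep_count (u ` H) X z = card {h \<in> H. u h - z \<in> X}" for z
  proof -
    have "{a \<in> u ` H. a - z \<in> X} = u ` {h \<in> H. u h - z \<in> X}" by auto
    moreover have "inj_on u {h \<in> H. u h - z \<in> X}" using injv by (auto intro: inj_on_subset)
    ultimately show ?thesis by (simp add: rep_count_def card_image)
  qed
  define I where "I = {(x, c, h). x \<in> X \<and> c \<in> C \<and> h \<in> H \<and> u h - x \<in> Z \<and> v h - c \<in> Y}"
  have finI: "finite I"
    by (rule finite_subset[of _ "X \<times> C \<times> H"]) (use fin in \<open>auto simp: I_def\<close>)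
  define J where "J = (SIGMA z:Z. SIGMA h:{h \<in> H. u h - z \<in> X}. {c \<in> C. v h - c \<in> Y})"
  have "card J = (\<Sum>z\<in>Z. \<Sum>h\<in>{h \<in> H. u h - z \<in> X}. card {c \<in> C. v h - c \<in> Y})"
    unfolding J_def using fin by (simp add: card_SigmaI)
  moreover have "(\<Sum>z\<in>Z. \<Sum>h\<in>{h \<in> H. u h - z \<in> X}. \<rho>) \<le> \<dots>"
    using rho by (intro sum_mono) auto
  moreover have "(\<Sum>z\<in>Z. \<tau> * \<rho>) \<le> (\<Sum>z\<in>Z. \<Sum>h\<in>{h \<in> H. u h - z \<in> X}. \<rho>)"
    using tau rdu by (intro sum_mono) auto
  ultimately have J: "t * T \<le> card J" by (simp add: t_def T_def)
  have "inj_on (\<lambda>(z, h, c). (u h - z, c, h)) J" by (auto simp: inj_on_def)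
  moreover have "(\<lambda>(z, h, c). (u h - z, c, h)) ` J \<subseteq> I" by (auto simp: J_def I_def)
  ultimately have "card J \<le> card I" using finI by (rule card_inj_on_le)
  then have tT: "t * T \<le> card I" using J by linarith
  obtain z0 where z0: "z0 \<in> Z" using pos(1) unfolding t_def by (metis card_eq_0_iff ex_in_conv less_irrefl)
  have tauX: "\<tau> \<le> card X"
  proof -
    have "inj_on (\<lambda>a. a - z0) {a \<in> u ` H. a - z0 \<in> X}" by (auto simp: inj_on_def)
    then have "rep_count (u ` H) X z0 \<le> card X" unfolding rep_count_def
      by (rule card_inj_on_le) (use fin in auto)
    then show ?thesis using tau[OF z0] by linarith
  qed
  have tauH: "\<tau> \<le> card H"
    using tau[OF z0] rdu[of z0] fin by (metis (no_types, lifting) card_mono le_trans mem_Collect_eq subsetI)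
  then obtain h0 where h0: "h0 \<in> H" using pos by (metis card.empty ex_in_conv le_zero_eq less_irrefl)
  have rhoY: "\<rho> \<le> q"
  proof -
    have "inj_on (\<lambda>c. v h0 - c) {c \<in> C. v h0 - c \<in> Y}" by (auto simp: inj_on_def)
    then have "card {c \<in> C. v h0 - c \<in> Y} \<le> card Y"
      by (rule card_inj_on_le) (use fin in auto)
    then show ?thesis using rho[OF h0] by (simp add: q_def)
  qed
  \<comment> \<open>A trivial estimate, from \<tau> \<le> card H \<le> card C; it settles the case
    in which no subdivision of the grid is required.\<close>
  have TP: "T ^ 2 \<le> P * q ^ 2"
  proof -
    have "T ^ 2 = (\<tau> * \<tau>) * (\<rho> * \<rho>)" by (simp add: T_def power2_eq_square)
    also have "\<dots> \<le> (card X * card C) * (q * q)"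
      using tauX tauH HC rhoY by (intro mult_mono) auto
    finally show ?thesis by (simp add: P_def power2_eq_square)
  qed
  have main: "t * T * K\<^sup>2 \<le> P * (2 * K + 1) * K\<^sup>2 + (t * q) * (t * q)" if K: "K \<ge> 1" for K
  proof -
    \<comment> \<open>Block lengths about t / K and q / K: at most 2 * K + 1 block numbers per
      translate, and a within-block term of at most (t * q)^2 / K^2.\<close>
    define m where "m = ceil_div t K"
    define n where "n = ceil_div q K"
    have "card I \<le> P * (t div m + q div n + 1) + t * (m - 1) * (q * (n - 1))"
      unfolding I_def P_def t_def q_def
      by (rule incidence_bound[OF fin curve]) (use ceil_div[OF K] in \<open>auto simp: m_def n_def\<close>)
    also have "\<dots> \<le> P * (2 * K + 1) + t * (m - 1) * (q * (n - 1))"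
      using ceil_div(2)[OF K, of t] ceil_div(2)[OF K, of q]
      by (intro add_mono mult_left_mono) (auto simp: m_def n_def)
    finally have "t * T * K\<^sup>2 \<le> (P * (2 * K + 1) + t * (m - 1) * (q * (n - 1))) * K\<^sup>2"
      using tT by (intro mult_right_mono) auto
    also have "\<dots> = P * (2 * K + 1) * K\<^sup>2 + (t * ((m - 1) * K)) * (q * ((n - 1) * K))"
      by (simp add: algebra_simps power2_eq_square)
    also have "\<dots> \<le> P * (2 * K + 1) * K\<^sup>2 + (t * t) * (q * q)"
      using ceil_div(3)[OF K, of t] ceil_div(3)[OF K, of q]
      by (intro add_mono mult_mono) (auto simp: m_def n_def)
    finally show ?thesis by (simp add: algebra_simps)
  qed
  \<comment> \<open>The least \<open>K\<close> for which the within-block term is at most half of t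
    * T, so that the block-crossing term must carry the other half. Minimality makes the defining
    inequality sharp up to a factor 4, unless K = 1.\<close>
  define K where "K = (LEAST K. K \<ge> 1 \<and> K\<^sup>2 * T \<ge> 2 * t * q\<^sup>2)"
  have ex: "\<exists>K. K \<ge> 1 \<and> K\<^sup>2 * T \<ge> 2 * t * q\<^sup>2"
  proof (intro exI conjI)
    show "1 \<le> 2 * t * q\<^sup>2 + 1" by simp
    have "2 * t * q\<^sup>2 \<le> (2 * t * q\<^sup>2 + 1) * 1" by simp
    also have "\<dots> \<le> (2 * t * q\<^sup>2 + 1)\<^sup>2 * T"
      using pos by (intro mult_mono) (auto simp: power2_eq_square)
    finally show "2 * t * q\<^sup>2 \<le> (2 * t * q\<^sup>2 + 1)\<^sup>2 * T" .
  qed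
  have K: "K \<ge> 1" "K\<^sup>2 * T \<ge> 2 * t * q\<^sup>2" using LeastI_ex[OF ex] unfolding K_def by auto
  have "2 * ((t * q) * (t * q)) = t * (2 * t * q\<^sup>2)" by (simp add: power2_eq_square algebra_simps)
  also have "\<dots> \<le> t * (K\<^sup>2 * T)" using K(2) by (intro mult_left_mono) auto
  finally have "2 * ((t * q) * (t * q)) \<le> t * T * K\<^sup>2" by (simp only: mult_ac)
  then have "t * T * K\<^sup>2 \<le> 2 * (P * (2 * K + 1) * K\<^sup>2)"
    using main[OF K(1)] by linarith
  then have "t * T * K\<^sup>2 \<le> 2 * (P * (2 * K + 1)) * K\<^sup>2" by (simp only: mult.assoc)
  then have "t * T \<le> 2 * (P * (2 * K + 1))" using K(1) by simp
  also have "\<dots> \<le> 2 * (P * (3 * K))" using K(1) by (intro mult_left_mono) auto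
  finally have tTK: "t * T \<le> 6 * P * K" by simp
  have "t * T ^ 3 \<le> 512 * (P * q)\<^sup>2"
  proof (cases "K = 1")
    case True
    have "t * T ^ 3 = (t * T) * T\<^sup>2" by (simp add: power2_eq_square power3_eq_cube)
    also have "\<dots> \<le> (6 * P) * (P * q\<^sup>2)"
      using tTK True by (intro mult_mono[OF _ TP]) auto
    also have "\<dots> \<le> 512 * (P * q)\<^sup>2" by (simp add: power2_eq_square)
    finally show ?thesis .
  next
    case False
    then have K2: "K - 1 \<ge> 1" using K by linarith
    have "\<not> ((K - 1)\<^sup>2 * T \<ge> 2 * t * q\<^sup>2)"
      using not_less_Least[of "K - 1" "\<lambda>K. K \<ge> 1 \<and> K\<^sup>2 * T \<ge> 2 * t * q\<^sup>2"] K2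
      unfolding K_def[symmetric] by auto
    then have k1: "(K - 1)\<^sup>2 * T \<le> 2 * t * q\<^sup>2" by linarith
    have "K\<^sup>2 \<le> (2 * (K - 1))\<^sup>2" using K2 by (intro power_mono) auto
    then have "K\<^sup>2 * T \<le> (2 * (K - 1))\<^sup>2 * T" by (intro mult_right_mono) auto
    also have "\<dots> = 4 * ((K - 1)\<^sup>2 * T)" by (simp add: power_mult_distrib)
    also have "\<dots> \<le> 4 * (2 * t * q\<^sup>2)" using k1 by (intro mult_left_mono) auto
    finally have KT: "K\<^sup>2 * T \<le> 8 * t * q\<^sup>2" by simp
    have "t * (t * T ^ 3) = (t * T)\<^sup>2 * T" by (simp add: power2_eq_square power3_eq_cube)
    also have "\<dots> \<le> (6 * P * K)\<^sup>2 * T" using tTK by (intro mult_right_mono power_mono) auto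
    also have "\<dots> = 36 * P\<^sup>2 * (K\<^sup>2 * T)" by (simp add: power_mult_distrib)
    also have "\<dots> \<le> 36 * P\<^sup>2 * (8 * t * q\<^sup>2)" using KT by (intro mult_left_mono) auto
    also have "\<dots> \<le> t * (512 * (P * q)\<^sup>2)" by (simp add: power_mult_distrib)
    finally show ?thesis using pos by simp
  qed
  then show ?thesis by (simp add: t_def T_def P_def q_def)
qed

section \<open>Moments of representation functions\<close>

lemma rep_count_mono:
  assumes "finite A" "A' \<subseteq> A" "X' \<subseteq> X"
  shows "rep_count A' X' z \<le> rep_count A X z"
  unfolding rep_count_def using assms by (intro card_mono) auto

lemma rep_count_le_card: "finite A \<Longrightarrow> rep_count A X z \<le> card A"
  unfolding rep_count_def by (intro card_mono) auto

definition diff_set :: "real set \<Rightarrow> real set \<Rightarrow> real set"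
  where "diff_set A X = (\<lambda>(a, x). a - x) ` (A \<times> X)"

lemma finite_diff_set [simp]: "finite A \<Longrightarrow> finite X \<Longrightarrow> finite (diff_set A X)"
  by (simp add: diff_set_def)

lemma rep_count_eq_0:
  assumes "z \<notin> diff_set A X"
  shows "rep_count A X z = 0"
proof -
  have "{a \<in> A. a - z \<in> X} = {}"
    using assms unfolding diff_set_def by force
  then show ?thesis unfolding rep_count_def by (metis card.empty)
qed

text \<open>For X = A this is the additive energy when k = 2 and the cubic energy E_3(A) when k =
  3.\<close>

definition rep_moment :: "nat \<Rightarrow> real set \<Rightarrow> real set \<Rightarrow> nat"
  where "rep_moment k A X = (\<Sum>z\<in>diff_set A X. rep_count A X z ^ k)"

lemma rep_moment_eq_sum:
  assumes "finite Z" "diff_set A X \<subseteq> Z" "k > 0"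
  shows "rep_moment k A X = (\<Sum>z\<in>Z. rep_count A X z ^ k)"
  unfolding rep_moment_def
  by (rule sum.mono_neutral_left) (use assms rep_count_eq_0 in auto)

lemma sum_rep_count_le_rep_moment:
  assumes "finite Z" "finite A" "finite X" "k > 0"
  shows "(\<Sum>z\<in>Z. rep_count A X z ^ k) \<le> rep_moment k A X"
  unfolding rep_moment_eq_sum[of "Z \<union> diff_set A X", OF _ _ assms(4)]
  using assms rep_moment_eq_sum[of "Z \<union> diff_set A X" A X k] by (auto intro!: sum_mono2)

lemma rep_moment_mono:
  assumes "finite A" "finite X" "A' \<subseteq> A" "X' \<subseteq> X" "k > 0"
  shows "rep_moment k A' X' \<le> rep_moment k A X"
proof -
  have "diff_set A' X' \<subseteq> diff_set A X" using assms by (auto simp: diff_set_def)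
  then have "rep_moment k A' X' = (\<Sum>z\<in>diff_set A X. rep_count A' X' z ^ k)"
    using assms by (intro rep_moment_eq_sum) auto
  also have "\<dots> \<le> rep_moment k A X" unfolding rep_moment_def
    using assms by (intro sum_mono power_mono rep_count_mono) auto
  finally show ?thesis .
qed

text \<open>Regroups the pairs (a, x) by their difference. Constant \<open>\<phi>\<close> gives the
  first moment; a power of \<open>rep_count\<close> splits a moment into the contributions of single
  elements.\<close>

lemma sum_rep_count_mult:
  fixes \<phi> :: "real \<Rightarrow> 'b::comm_semiring_1"
  assumes "finite Z" "finite A" "finite X" "diff_set A X \<subseteq> Z"
  shows "(\<Sum>z\<in>Z. of_nat (rep_count A X z) * \<phi> z) = (\<Sum>a\<in>A. \<Sum>x\<in>X. \<phi> (a - x))"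
proof -
  have "(\<Sum>z\<in>Z. of_nat (rep_count A X z) * \<phi> z) = (\<Sum>z\<in>Z. \<Sum>a\<in>{a \<in> A. a - z \<in> X}. \<phi> z)"
    by (simp add: rep_count_def)
  also have "\<dots> = (\<Sum>(z, a)\<in>(SIGMA z:Z. {a \<in> A. a - z \<in> X}). \<phi> z)"
    using assms by (intro sum.Sigma) auto
  also have "\<dots> = (\<Sum>(a, x)\<in>A \<times> X. \<phi> (a - x))"
    by (rule sum.reindex_bij_witness[where i = "\<lambda>(a, x). (a - x, a)" and j = "\<lambda>(z, a). (a, a - z)"])
      (use assms(4) in \<open>auto simp: diff_set_def\<close>)
  also have "\<dots> = (\<Sum>a\<in>A. \<Sum>x\<in>X. \<phi> (a - x))"
    by (simp add: sum.cartesian_product)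
  finally show ?thesis .
qed

lemma sum_rep_count:
  assumes "finite Z" "finite A" "finite X" "diff_set A X \<subseteq> Z"
  shows "(\<Sum>z\<in>Z. rep_count A X z) = card A * card X"
  using sum_rep_count_mult[OF assms, of "\<lambda>_. 1::nat"] by simp

lemma rep_moment_1:
  assumes "finite A" "finite X"
  shows "rep_moment 1 A X = card A * card X"
  unfolding rep_moment_def using sum_rep_count[of "diff_set A X" A X] assms by simp

lemma rep_moment_le:
  assumes "finite A" "finite X"
  shows "rep_moment (Suc k) A X \<le> card A ^ Suc k * card X"
proof -
  have "rep_moment (Suc k) A X = (\<Sum>z\<in>diff_set A X. rep_count A X z ^ k * rep_count A X z)"
    by (simp add: rep_moment_def mult.commute)
  also have "\<dots> \<le> (\<Sum>z\<in>diff_set A X. card A ^ k * rep_count A X z)"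
    using assms by (intro sum_mono mult_right_mono power_mono rep_count_le_card) auto
  also have "\<dots> = card A ^ k * rep_moment 1 A X" by (simp add: rep_moment_def sum_distrib_left)
  also have "\<dots> = card A ^ Suc k * card X" using rep_moment_1[OF assms] by simp
  finally show ?thesis .
qed

lemma rep_moment_pos:
  assumes "finite A" "A \<noteq> {}"
  shows "rep_moment k A A \<ge> 1"
proof -
  have "0 \<in> diff_set A A" using assms by (force simp: diff_set_def)
  then have "rep_count A A 0 ^ k \<le> rep_moment k A A"
    unfolding rep_moment_def using assms by (intro member_le_sum) auto
  moreover have "rep_count A A 0 = card A" by (simp add: rep_count_def)
  moreover have "card A \<ge> 1" using assms by (simp add: Suc_leI card_gt_0_iff)
  ultimately show ?thesis by (metis one_le_power order_trans)
qed

lemma rep_count_uminus: "rep_count (uminus ` A) (uminus ` X) z = rep_count A X (- z)"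
proof -
  have "{a \<in> uminus ` A. a - z \<in> uminus ` X} = uminus ` {a \<in> A. a - (- z) \<in> X}"
  proof safe
    fix a x assume *: "- a - z = - x" "a \<in> A" "x \<in> X"
    then have "x = a + z" by linarith
    then have "a \<in> {a \<in> A. a - (- z) \<in> X}" using *(2,3) by simp
    then show "- a \<in> uminus ` {a \<in> A. a - (- z) \<in> X}" by (rule imageI)
  next
    fix a assume "a \<in> A" "a - (- z) \<in> X"
    then have "- (a - - z) \<in> uminus ` X" by (intro imageI)
    then show "- a - z \<in> uminus ` X" by simp
  qed auto
  then show ?thesis unfolding rep_count_def by (simp add: card_image)
qed

text \<open>Allows decreasing pieces of a graph to be treated through -f.\<close>

lemma rep_moment_uminus: "rep_moment k (uminus ` A) (uminus ` X) = rep_moment k A X"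
proof -
  have "diff_set (uminus ` A) (uminus ` X) = uminus ` diff_set A X"
    by (force simp: diff_set_def image_iff)
  then have "rep_moment k (uminus ` A) (uminus ` X) = (\<Sum>z\<in>uminus ` diff_set A X. rep_count A X (- z) ^ k)"
    unfolding rep_moment_def by (simp add: rep_count_uminus)
  also have "\<dots> = rep_moment k A X" unfolding rep_moment_def by (simp add: sum.reindex)
  finally show ?thesis .
qed

section \<open>Dyadic levels and sets stable under deletion\<close>

text \<open>One of the L levels carries at least a 1/L share of the moment; 2 ^ k is the loss from
  replacing \<open>r z\<close> by the lower end of its level.\<close>

lemma dyadic_pigeonhole:
  fixes r :: "'a \<Rightarrow> nat"
  assumes "finite Z" "\<And>z. z \<in> Z \<Longrightarrow> r z < 2 ^ L" "k > 0" "L > 0"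
  shows "\<exists>j<L. (\<Sum>z\<in>Z. r z ^ k) \<le> L * 2 ^ k * (2 ^ j) ^ k * card {z \<in> Z. 2 ^ j \<le> r z \<and> r z < 2 ^ Suc j}"
proof -
  define g where "g = (\<lambda>j. 2 ^ k * (2 ^ j) ^ k * card {z \<in> Z. 2 ^ j \<le> r z \<and> r z < 2 ^ Suc j})"
  obtain j where j: "j < L" "\<And>i. i < L \<Longrightarrow> g i \<le> g j"
  proof -
    have "Max (g ` {..<L}) \<in> g ` {..<L}" using assms(4) by (intro Max_in) auto
    then obtain j where "j < L" "g j = Max (g ` {..<L})" by auto
    then show ?thesis using that[of j] by simp
  qed
  have "r z ^ k \<le> (\<Sum>i<L. if 2 ^ i \<le> r z \<and> r z < 2 ^ Suc i then 2 ^ k * (2 ^ i) ^ k else 0)"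
    if z: "z \<in> Z" for z
  proof (cases "r z = 0")
    case True
    then show ?thesis using assms(3) by simp
  next
    case False
    then obtain i where i: "2 ^ i \<le> r z" "r z < 2 ^ (i + 1)"
      using ex_power_ivl1[of 2 "r z"] by auto
    have "(2::nat) ^ i < 2 ^ L" using i(1) assms(2)[OF z] by linarith
    then have iL: "i < L" by simp
    have "r z ^ k \<le> (2 ^ (i + 1)) ^ k" using i by (intro power_mono) auto
    also have "\<dots> = (if 2 ^ i \<le> r z \<and> r z < 2 ^ Suc i then 2 ^ k * (2 ^ i) ^ k else 0)"
      using i by (simp add: power_mult_distrib)
    also have "\<dots> \<le> (\<Sum>i<L. if 2 ^ i \<le> r z \<and> r z < 2 ^ Suc i then 2 ^ k * (2 ^ i) ^ k else 0)"
      using iL by (intro member_le_sum) auto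
    finally show ?thesis .
  qed
  then have "(\<Sum>z\<in>Z. r z ^ k) \<le>
      (\<Sum>z\<in>Z. \<Sum>i<L. if 2 ^ i \<le> r z \<and> r z < 2 ^ Suc i then 2 ^ k * (2 ^ i) ^ k else 0)"
    by (rule sum_mono)
  also have "\<dots> = (\<Sum>i<L. \<Sum>z\<in>Z. if 2 ^ i \<le> r z \<and> r z < 2 ^ Suc i then 2 ^ k * (2 ^ i) ^ k else 0)"
    by (rule sum.swap)
  also have "\<dots> = (\<Sum>i<L. g i)"
    unfolding g_def using assms(1) by (intro sum.cong) (auto simp: sum.If_cases Int_def)
  also have "\<dots> \<le> L * g j" using sum_bounded_above[of "{..<L}" g "g j"] j by simp
  finally show ?thesis using j(1) unfolding g_def by (auto simp: mult.assoc)
qed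

text \<open>Such a set can lose a fraction 1/(2 L) of its elements, chosen arbitrarily, and still
  keep half of \<open>\<mu>\<close>; this permits discarding exceptional elements whose structure is
  unknown.\<close>

definition stable_under_deletion :: "nat \<Rightarrow> (real set \<Rightarrow> nat) \<Rightarrow> real set \<Rightarrow> bool"
  where "stable_under_deletion L \<mu> A \<longleftrightarrow>
    (\<forall>A'\<subseteq>A. 2 * L * card (A - A') \<le> card A \<longrightarrow> \<mu> A \<le> 2 * \<mu> A')"

text \<open>Take the nonempty subset \<open>A'\<close> that minimises \<open>\<mu> A' / |A'|\<^sup>L\<close>.\<close>

lemma exists_stable_subset:
  assumes fin: "finite A" "A \<noteq> {}" and L: "L > 0"
    and pos: "\<And>A'. A' \<subseteq> A \<Longrightarrow> A' \<noteq> {} \<Longrightarrow> \<mu> A' \<ge> 1" and up: "\<mu> A \<le> 2 ^ L"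
  shows "\<exists>A'\<subseteq>A. A' \<noteq> {} \<and> card A \<le> 2 * card A' \<and> stable_under_deletion L \<mu> A'"
proof -
  define q where "q = (\<lambda>A'. real (\<mu> A') / real (card A') ^ L)"
  have "finite (Pow A - {{}})" "Pow A - {{}} \<noteq> {}" using fin by auto
  then obtain M where M: "M \<in> Pow A - {{}}" "\<And>A'. A' \<in> Pow A - {{}} \<Longrightarrow> q M \<le> q A'"
    using ex_is_arg_min_if_finite[of "Pow A - {{}}" q] unfolding is_arg_min_def
    by (meson linorder_not_less)
  have finM: "finite M" "M \<noteq> {}" "M \<subseteq> A" using M(1) fin finite_subset by auto
  have cross: "\<mu> M * card A' ^ L \<le> \<mu> A' * card M ^ L" if A': "A' \<subseteq> A" "A' \<noteq> {}" for A'
  proof -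
    have "card A' > 0" "card M > 0" using A' finM fin finite_subset by (auto simp: card_gt_0_iff)
    then have "real (\<mu> M) * real (card A') ^ L \<le> real (\<mu> A') * real (card M) ^ L"
      using M(2)[of A'] A' unfolding q_def by (auto simp: field_simps)
    then have "real (\<mu> M * card A' ^ L) \<le> real (\<mu> A' * card M ^ L)" by simp
    then show ?thesis by (simp only: of_nat_le_iff)
  qed
  have "card A ^ L \<le> \<mu> M * card A ^ L" using pos[of M] finM by simp
  also have "\<dots> \<le> \<mu> A * card M ^ L" using cross[of A] fin by simp
  also have "\<dots> \<le> (2 * card M) ^ L" using up by (simp add: power_mult_distrib)
  finally have "card A \<le> 2 * card M" using L power_mono_iff[of "card A" "2 * card M" L] by blast
  moreover have "stable_under_deletion L \<mu> M"
    unfolding stable_under_deletion_def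
  proof (intro allI impI)
    fix A' assume A': "A' \<subseteq> M" "2 * L * card (M - A') \<le> card M"
    have cM: "card M > 0" using finM by (simp add: card_gt_0_iff)
    have fA': "finite A'" using A' finM finite_subset by auto
    have cd: "card (M - A') = card M - card A'" "card A' \<le> card M"
      using A' finM fA' by (auto simp: card_Diff_subset card_mono)
    then have le: "2 * real L * (real (card M) - real (card A')) \<le> real (card M)"
      using A'(2) by (metis of_nat_diff of_nat_le_iff of_nat_mult of_nat_numeral)
    define y where "y = real (card M)"
    have lo: "y * (1 + - (1 / (2 * real L))) \<le> real (card A')"
      using le L by (simp add: y_def field_simps)
    have L1: "1 / (2 * real L) \<le> 1 / 2" using L by (simp add: field_simps)
    have ypos: "y > 0" using cM by (simp add: y_def)
    have "y * (1 + - (1 / (2 * real L))) > 0" using ypos L1 by (intro mult_pos_pos) auto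
    then have cA': "real (card A') > 0" using lo by linarith
    then have A'ne: "A' \<noteq> {}" by auto
    \<comment> \<open>By Bernoulli (1 - 1/(2 L))^L is at least 1/2, which is where the fraction 1/(2
      L) comes from.\<close>
    have "1 / 2 = 1 + real L * - (1 / (2 * real L))" using L by simp
    also have "\<dots> \<le> (1 + - (1 / (2 * real L))) ^ L"
      using L1 by (intro Bernoulli_inequality) linarith
    finally have "y ^ L * (1 / 2) \<le> y ^ L * (1 + - (1 / (2 * real L))) ^ L"
      using ypos by (intro mult_left_mono) auto
    also have "\<dots> \<le> real (card A') ^ L"
      unfolding power_mult_distrib[symmetric]
      using lo ypos L1 by (intro power_mono) auto
    finally have "real (card M ^ L) \<le> real (2 * card A' ^ L)" by (simp add: y_def)
    then have "card M ^ L \<le> 2 * card A' ^ L" by (simp only: of_nat_le_iff)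
    then have "\<mu> M * card A' ^ L \<le> \<mu> A' * (2 * card A' ^ L)"
      using cross[of A'] A'(1) A'ne finM by (meson mult_le_mono2 order_trans)
    then show "\<mu> M \<le> 2 * \<mu> A'" using cA' by simp
  qed
  ultimately show ?thesis using finM by blast
qed

section \<open>Third moments against cubic energy\<close>

lemma rep_moment_Suc:
  assumes "finite A" "finite X"
  shows "rep_moment (Suc k) A X = (\<Sum>a\<in>A. \<Sum>x\<in>X. rep_count A X (a - x) ^ k)"
  using sum_rep_count_mult[of "diff_set A X" A X "\<lambda>z. rep_count A X z ^ k"] assms by (simp add: rep_moment_def)

lemma less_two_power:
  fixes n L :: nat
  assumes "n ^ 4 \<le> 2 ^ L" "L > 0"
  shows "n < 2 ^ L"
proof (cases "n \<le> 1")
  case True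
  moreover have "(1::nat) < 2 ^ L" using assms by (intro one_less_power) auto
  ultimately show ?thesis by linarith
next
  case False
  then have "n ^ 1 < n ^ 4" by (intro power_strict_increasing) auto
  then show ?thesis using assms by simp
qed

text \<open>
  The elements \<open>h\<close> contributing at least a quarter of the average to the cubic energy of \<open>v ` M\<close> are
  numerous, since deleting them would make the energy drop; a dyadic pigeonhole makes the popularity
  of the differences used uniform.
\<close>

lemma popular_differences:
  fixes A :: "real set" and v :: "real \<Rightarrow> real"
  assumes fin: "finite A" "A \<noteq> {}" and injv: "inj_on v A"
    and L: "L \<ge> 8" "card A ^ 4 \<le> 2 ^ L"
  obtains H M Y \<rho> where "\<rho> > 0" "H \<subseteq> M" "M \<subseteq> A" "H \<noteq> {}" "finite Y" "card A \<le> L ^ 3 * card H"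
    "\<forall>h\<in>H. \<rho> \<le> card {c \<in> v ` M. v h - c \<in> Y}"
    "rep_moment 3 (v ` M) (v ` M) * card Y ^ 2 \<le> (16 * L * card M * \<rho>) ^ 3"
proof -
  define \<mu> where "\<mu> = (\<lambda>A. rep_moment 3 (v ` A) (v ` A))"
  have cardv: "card (v ` S) = card S" if "S \<subseteq> A" for S
    using that injv by (meson card_image inj_on_subset)
  \<comment> \<open>The trivial bound E_3 \<le> |A|^4 explains the fourth power in the hypothesis on
    \<open>L\<close>.\<close>
  have up: "\<mu> A \<le> 2 ^ L"
  proof -
    have "\<mu> A \<le> card (v ` A) ^ Suc 2 * card (v ` A)"
      unfolding \<mu>_def using rep_moment_le[of "v ` A" "v ` A" 2] fin by (simp add: numeral_3_eq_3)
    also have "\<dots> = card A ^ 4" using cardv[of A] by (simp add: power4_eq_xxxx power3_eq_cube)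
    finally show ?thesis using L by linarith
  qed
  have "\<exists>A'\<subseteq>A. A' \<noteq> {} \<and> card A \<le> 2 * card A' \<and> stable_under_deletion L \<mu> A'"
  proof (rule exists_stable_subset)
    show "\<mu> A' \<ge> 1" if "A' \<subseteq> A" "A' \<noteq> {}" for A'
      unfolding \<mu>_def using that fin by (intro rep_moment_pos) (auto dest: finite_subset)
  qed (use L fin up in auto)
  then obtain M where M: "M \<subseteq> A" "M \<noteq> {}" "card A \<le> 2 * card M" "stable_under_deletion L \<mu> M"
    by blast
  have finM: "finite M" using M fin finite_subset by blast
  define V where "V = v ` M"
  define r where "r = rep_count V V"
  define E where "E = \<mu> M"
  \<comment> \<open>The share of \<open>p\<close> in the cubic energy, once the latter is written as
    a sum over pairs (p, q).\<close>
  define \<sigma> where "\<sigma> = (\<lambda>p. \<Sum>q\<in>V. r (p - q) ^ 2)"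
  define n where "n = card M"
  have finV: "finite V" and cV: "card V = n" using finM cardv M by (auto simp: V_def n_def)
  have E1: "E \<ge> 1" unfolding E_def \<mu>_def using finM M by (intro rep_moment_pos) auto
  have n1: "n \<ge> 1" using finM M by (simp add: n_def Suc_leI card_gt_0_iff)
  define H where "H = {a \<in> M. E \<le> 4 * n * \<sigma> (v a)}"
  have HM: "H \<subseteq> M" by (auto simp: H_def)
  have "card M < 2 * L * card H"
  proof (rule ccontr)
    assume "\<not> ?thesis"
    then have "2 * L * card (M - (M - H)) \<le> card M" using HM by (simp add: double_diff)
    then have st: "E \<le> 2 * \<mu> (M - H)" using M(4) unfolding stable_under_deletion_def E_def by blast
    define S where "S = M - H"
    have SM: "S \<subseteq> M" by (auto simp: S_def)
    have injS: "inj_on v S" using injv SM M(1) by (meson inj_on_subset subset_trans)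
    have "\<mu> S = (\<Sum>p\<in>v ` S. \<Sum>q\<in>v ` S. rep_count (v ` S) (v ` S) (p - q) ^ 2)"
      unfolding \<mu>_def using rep_moment_Suc[of "v ` S" "v ` S" 2] SM finM finite_subset
      by (auto simp: numeral_3_eq_3)
    also have "\<dots> \<le> (\<Sum>p\<in>v ` S. \<Sum>q\<in>v ` S. r (p - q) ^ 2)"
      unfolding r_def V_def using SM finM by (intro sum_mono power_mono rep_count_mono) auto
    also have "\<dots> \<le> (\<Sum>p\<in>v ` S. \<sigma> p)"
      unfolding \<sigma>_def V_def using SM finM by (intro sum_mono sum_mono2) auto
    also have "\<dots> = (\<Sum>a\<in>S. \<sigma> (v a))" using injS by (simp add: sum.reindex)
    \<comment> \<open>Elements outside \<open>H\<close> contribute less than E / (4 n) each, so E /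
      4 in total, whereas stability would leave at least E / 2.\<close>
    finally have "4 * n * \<mu> S \<le> (\<Sum>a\<in>S. 4 * n * \<sigma> (v a))" by (simp add: sum_distrib_left[symmetric])
    also have "\<dots> \<le> (\<Sum>a\<in>S. E)" by (intro sum_mono) (auto simp: S_def H_def)
    also have "\<dots> \<le> n * E" using card_mono[OF finM SM] by (simp add: n_def)
    finally have "4 * \<mu> S \<le> E" using n1 by simp
    then show False using st E1 unfolding S_def by linarith
  qed
  then have cH: "card A \<le> 4 * L * card H" using M(3) by linarith
  have finH: "finite H" using HM finM finite_subset by blast
  have rL: "r z < 2 ^ L" for z
  proof -
    have "r z \<le> card V" unfolding r_def by (rule rep_count_le_card[OF finV])
    also have "\<dots> \<le> card A" using M(1) fin cV by (simp add: n_def card_mono)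
    also have "\<dots> < 2 ^ L" using less_two_power L by simp
    finally show ?thesis .
  qed
  define lev where "lev = (\<lambda>h j. j < L \<and>
      \<sigma> (v h) \<le> L * 2 ^ 2 * (2 ^ j) ^ 2 * card {q \<in> V. 2 ^ j \<le> r (v h - q) \<and> r (v h - q) < 2 ^ Suc j})"
  have "\<exists>j. lev h j" for h
    unfolding lev_def \<sigma>_def
    using dyadic_pigeonhole[of V "\<lambda>q. r (v h - q)" L 2] finV rL L by auto
  then obtain J where J: "\<And>h. lev h (J h)" by metis
  have "J \<in> H \<rightarrow> {..<L}" using J unfolding lev_def by auto
  \<comment> \<open>The best level depends on \<open>h\<close>; a pigeonhole over the elements of
    \<open>H\<close> fixes a common one at the cost of another factor L.\<close>
  then have "\<exists>j\<in>{..<L}. card H \<le> card (J -` {j} \<inter> H) * card {..<L}"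
    by (rule pigeonhole_card) (use finH L in \<open>auto simp: lessThan_empty_iff\<close>)
  then obtain j where j: "card H \<le> card (J -` {j} \<inter> H) * L" by auto
  define H' where "H' = J -` {j} \<inter> H"
  define \<Delta> :: nat where "\<Delta> = 2 ^ j"
  define Y where "Y = {y \<in> diff_set V V. \<Delta> \<le> r y}"
  have finY: "finite Y" using finV by (simp add: Y_def)
  have "card A \<le> 4 * L * (card H' * L)" using cH j unfolding H'_def by (meson mult_le_mono2 order_trans)
  also have "\<dots> = (4 * (L * L)) * card H'" by simp
  also have "\<dots> \<le> L ^ 3 * card H'" using L by (intro mult_right_mono) (auto simp: power3_eq_cube)
  finally have cH': "card A \<le> L ^ 3 * card H'" .
  have H'ne: "H' \<noteq> {}" using cH' fin by auto
  have finH': "finite H'" using finH by (simp add: H'_def)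
  define cnt where "cnt = (\<lambda>h. card {c \<in> V. v h - c \<in> Y})"
  have Ele: "E \<le> 16 * L * n * \<Delta> ^ 2 * cnt h" if h: "h \<in> H'" for h
  proof -
    have hM: "h \<in> M" using h HM by (auto simp: H'_def)
    have "J h = j" using h by (auto simp: H'_def)
    then have "\<sigma> (v h) \<le> L * 2 ^ 2 * \<Delta> ^ 2 * card {q \<in> V. \<Delta> \<le> r (v h - q) \<and> r (v h - q) < 2 ^ Suc j}"
      using J[of h] unfolding lev_def \<Delta>_def by simp
    also have "\<dots> \<le> L * 2 ^ 2 * \<Delta> ^ 2 * cnt h"
      unfolding cnt_def using finV hM
      by (intro mult_left_mono card_mono) (auto simp: Y_def diff_set_def V_def)
    finally have "4 * n * \<sigma> (v h) \<le> 4 * n * (L * 2 ^ 2 * \<Delta> ^ 2 * cnt h)" by (intro mult_left_mono) auto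
    moreover have "E \<le> 4 * n * \<sigma> (v h)" using h by (auto simp: H'_def H_def)
    ultimately have "E \<le> 4 * n * (L * 2 ^ 2 * \<Delta> ^ 2 * cnt h)" by linarith
    then show ?thesis by (simp add: mult_ac)
  qed
  define \<rho> where "\<rho> = Min (cnt ` H')"
  have "\<rho> \<in> cnt ` H'" unfolding \<rho>_def using finH' H'ne by (intro Min_in) auto
  then have E\<rho>: "E \<le> 16 * L * n * \<Delta> ^ 2 * \<rho>" using Ele by auto
  have YE: "card Y * \<Delta> ^ 3 \<le> E"
  proof -
    have "card Y * \<Delta> ^ 3 = (\<Sum>y\<in>Y. \<Delta> ^ 3)" by simp
    also have "\<dots> \<le> (\<Sum>y\<in>Y. r y ^ 3)" by (intro sum_mono power_mono) (auto simp: Y_def)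
    also have "\<dots> \<le> E" unfolding E_def \<mu>_def r_def V_def[symmetric]
      using finY finV by (intro sum_rep_count_le_rep_moment) auto
    finally show ?thesis .
  qed
  have "\<Delta> > 0" by (simp add: \<Delta>_def)
  have pw: "(\<Delta> ^ 3) ^ 2 = \<Delta> ^ 6" "(\<Delta> ^ 2) ^ 3 = \<Delta> ^ 6" "E ^ 3 = E * E ^ 2"
    by (simp_all flip: power_mult power_Suc)
  \<comment> \<open>Eliminates the unknown level: the square of \<open>YE\<close> against the cube
    of \<open>E\<rho>\<close> cancels \<Delta>^6 and E^2.\<close>
  have "(E * card Y ^ 2) * \<Delta> ^ 6 * E ^ 2 = (card Y * \<Delta> ^ 3) ^ 2 * E ^ 3"
    unfolding power_mult_distrib pw by (simp only: mult_ac)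
  also have "\<dots> \<le> E ^ 2 * (16 * L * n * \<Delta> ^ 2 * \<rho>) ^ 3"
    using YE E\<rho> by (intro mult_mono power_mono) auto
  also have "\<dots> = (16 * L * n * \<rho>) ^ 3 * \<Delta> ^ 6 * E ^ 2"
    unfolding power_mult_distrib pw by (simp only: mult_ac)
  finally have main: "E * card Y ^ 2 \<le> (16 * L * n * \<rho>) ^ 3" using E1 \<open>\<Delta> > 0\<close> by simp
  show ?thesis
  proof (rule that[of \<rho> H' M Y])
    show "\<rho> > 0" using E\<rho> E1 by (cases \<rho>) auto
    show "H' \<subseteq> M" using HM by (auto simp: H'_def)
    show "\<forall>h\<in>H'. \<rho> \<le> card {c \<in> v ` M. v h - c \<in> Y}"
      using finH' unfolding \<rho>_def cnt_def V_def by (intro ballI Min_le) auto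
    show "rep_moment 3 (v ` M) (v ` M) * card Y ^ 2 \<le> (16 * L * card M * \<rho>) ^ 3"
      using main by (simp add: E_def \<mu>_def n_def)
  qed (use M H'ne finY cH' in auto)
qed

text \<open>Translating the curve by X and by the image of \<open>M\<close> under \<open>v\<close>,
  each representation in u(H) - X is amplified \<open>\<rho>\<close> times, because v h - c often
  falls into the set \<open>Y\<close> of popular differences. A large cubic energy makes
  \<open>Y\<close> small relative to \<open>\<rho>\<close>, so few translates can be rich.\<close>

lemma cubic_moment_tradeoff:
  assumes fin: "finite A" "A \<noteq> {}" and curve: "increasing_curve u v A"
    and L: "L \<ge> 8" "card A ^ 4 \<le> 2 ^ L"
  obtains H M where "H \<subseteq> M" "M \<subseteq> A" "H \<noteq> {}" "card A \<le> L ^ 3 * card H"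
    "\<forall>X. finite X \<longrightarrow> rep_moment 3 (u ` H) X * rep_moment 3 (v ` M) (v ` M) \<le> L ^ 12 * card A ^ 5 * card X ^ 2"
proof -
  have inj: "inj_on u A" "inj_on v A" using curve by (auto simp: increasing_curve_def)
  obtain \<rho> H M Y where "\<rho> > 0" and *: "H \<subseteq> M" "M \<subseteq> A" "H \<noteq> {}" "finite Y" "card A \<le> L ^ 3 * card H"
    and rho': "\<forall>h\<in>H. \<rho> \<le> card {c \<in> v ` M. v h - c \<in> Y}"
    and EY: "rep_moment 3 (v ` M) (v ` M) * card Y ^ 2 \<le> (16 * L * card M * \<rho>) ^ 3"
    by (rule popular_differences[OF fin inj(2) L])
  have rho: "\<rho> \<le> card {c \<in> v ` M. v h - c \<in> Y}" if "h \<in> H" for h using rho' that by blast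
  define E where "E = rep_moment 3 (v ` M) (v ` M)"
  define n where "n = card M"
  define y where "y = card Y"
  have finM: "finite M" and finH: "finite H" using *(1,2) fin(1) by (auto dest: finite_subset)
  have cV: "card (v ` M) = n" unfolding n_def using inj * by (meson card_image inj_on_subset)
  have HV: "card H \<le> card (v ` M)" unfolding cV n_def using * finM by (intro card_mono)
  have curveH: "increasing_curve u v H" using curve * by (meson increasing_curve_subset subset_trans)
  have main: "rep_moment 3 (u ` H) X * E \<le> L ^ 12 * card A ^ 5 * card X ^ 2" if X: "finite X" for X
  proof -
    define m where "m = rep_moment 3 (u ` H) X"
    have rdL: "rep_count (u ` H) X z < 2 ^ L" for z
    proof -
      have "rep_count (u ` H) X z \<le> card (u ` H)" using finH by (intro rep_count_le_card) auto
      also have "\<dots> \<le> card H" using finH by (rule card_image_le)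
      also have "\<dots> \<le> card A" using * fin by (intro card_mono) auto
      also have "\<dots> < 2 ^ L" using less_two_power L by simp
      finally show ?thesis .
    qed
    obtain i where i: "m \<le> L * 2 ^ 3 * (2 ^ i) ^ 3 *
        card {z \<in> diff_set (u ` H) X. 2 ^ i \<le> rep_count (u ` H) X z \<and> rep_count (u ` H) X z < 2 ^ Suc i}"
      unfolding m_def rep_moment_def
      using dyadic_pigeonhole[of "diff_set (u ` H) X" "rep_count (u ` H) X" L 3, OF _ rdL] finH X L(1) by auto
    define Z where "Z = {z \<in> diff_set (u ` H) X. 2 ^ i \<le> rep_count (u ` H) X z \<and> rep_count (u ` H) X z < 2 ^ Suc i}"
    have "card Z * (2 ^ i * \<rho>) ^ 3 \<le> 512 * (card X * card (v ` M) * card Y) ^ 2"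
      by (rule rich_translates_bound[OF X _ _ *(4) finH curveH HV rho])
        (use finM finH X in \<open>auto simp: Z_def\<close>)
    then have ST: "card Z * (2 ^ i * \<rho>) ^ 3 \<le> 512 * (card X * n * y) ^ 2" by (simp add: cV y_def)
    have "m * \<rho> ^ 3 \<le> (L * 2 ^ 3 * (2 ^ i) ^ 3 * card Z) * \<rho> ^ 3"
      using i unfolding Z_def by (intro mult_right_mono) auto
    also have "\<dots> = 8 * L * (card Z * (2 ^ i * \<rho>) ^ 3)" by (simp add: power_mult_distrib)
    also have "\<dots> \<le> 8 * L * (512 * (card X * n * y) ^ 2)" using ST by (intro mult_left_mono) auto
    finally have m\<rho>: "m * \<rho> ^ 3 \<le> 4096 * L * (card X * n * y) ^ 2" by simp
    \<comment> \<open>The two estimates share \<rho>^3 and y^2; multiplying them removes both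
      unknowns.\<close>
    have "m * E * y ^ 2 \<le> m * (16 * L * n * \<rho>) ^ 3"
      using EY by (simp add: E_def y_def n_def mult.assoc)
    also have "\<dots> = (16 * L * n) ^ 3 * (m * \<rho> ^ 3)" by (simp add: power_mult_distrib)
    also have "\<dots> \<le> (16 * L * n) ^ 3 * (4096 * L * (card X * n * y) ^ 2)"
      using m\<rho> by (intro mult_left_mono) auto
    also have "\<dots> = (8 ^ 8 * L ^ 4 * n ^ 5 * card X ^ 2) * y ^ 2"
    proof -
      have pw: "n ^ 5 = n ^ 3 * n ^ 2" "L ^ 4 = L ^ 3 * L" "(8::nat) ^ 8 = 16 ^ 3 * 4096"
        using power_add[of n 3 2] power_add[of L 3 1] by simp_all
      show ?thesis unfolding power_mult_distrib pw by (simp only: mult_ac)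
    qed
    finally have le: "m * E * y ^ 2 \<le> (8 ^ 8 * L ^ 4 * n ^ 5 * card X ^ 2) * y ^ 2" .
    have "m * E \<le> 8 ^ 8 * L ^ 4 * n ^ 5 * card X ^ 2"
    proof -
      obtain h where h: "h \<in> H" using *(3) by auto
      have "0 < card {c \<in> v ` M. v h - c \<in> Y}" using rho[OF h] \<open>\<rho> > 0\<close> by linarith
      then have "{c \<in> v ` M. v h - c \<in> Y} \<noteq> {}" unfolding card_gt_0_iff by (rule conjunct1)
      then have "Y \<noteq> {}" by blast
      then have "y > 0" using *(4) by (simp add: y_def card_gt_0_iff)
      then show ?thesis using le by simp
    qed
    \<comment> \<open>The constant 8^8 = 16^3 * 4096 is absorbed by L \<ge> 8.\<close>
    also have "\<dots> \<le> L ^ 8 * L ^ 4 * card A ^ 5 * card X ^ 2"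
      using L(1) card_mono[OF fin(1) *(2)] by (intro mult_mono power_mono) (auto simp: n_def)
    finally show ?thesis by (simp add: m_def flip: power_add)
  qed
  show ?thesis
    by (rule that[OF *(1-3,5)]) (use main in \<open>auto simp: E_def\<close>)
qed

section \<open>Lower bounds for sumsets\<close>

text \<open>Hoelder with exponents 3 and 3/2, from two Cauchy--Schwarz steps: P^2 \<le> Q S and Q^2
  \<le> P R, and eliminating Q leaves P^4 \<le> P R S^2.\<close>

lemma sum_mult_square_cubed_le:
  fixes r s :: "'a \<Rightarrow> real"
  assumes "\<And>i. i \<in> I \<Longrightarrow> r i \<ge> 0" "\<And>i. i \<in> I \<Longrightarrow> s i \<ge> 0"
  shows "(\<Sum>i\<in>I. r i * s i ^ 2) ^ 3 \<le> (\<Sum>i\<in>I. r i ^ 3) * (\<Sum>i\<in>I. s i ^ 3) ^ 2"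
proof -
  define P where "P = (\<Sum>i\<in>I. r i * s i ^ 2)"
  define Q where "Q = (\<Sum>i\<in>I. s i * r i ^ 2)"
  define R where "R = (\<Sum>i\<in>I. r i ^ 3)"
  define S where "S = (\<Sum>i\<in>I. s i ^ 3)"
  have cs: "(\<Sum>i\<in>I. x i * y i ^ 2) ^ 2 \<le> (\<Sum>i\<in>I. y i * x i ^ 2) * (\<Sum>i\<in>I. y i ^ 3)"
    if "\<And>i. i \<in> I \<Longrightarrow> y i \<ge> 0" for x y :: "'a \<Rightarrow> real"
  proof -
    have "(\<Sum>i\<in>I. x i * y i ^ 2) = (\<Sum>i\<in>I. (x i * sqrt (y i)) * (y i * sqrt (y i)))"
      using that by (intro sum.cong) (auto simp: power2_eq_square)
    also have "\<dots> ^ 2 \<le> (\<Sum>i\<in>I. (x i * sqrt (y i)) ^ 2) * (\<Sum>i\<in>I. (y i * sqrt (y i)) ^ 2)"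
      by (rule Cauchy_Schwarz_ineq_sum)
    also have "\<dots> = (\<Sum>i\<in>I. y i * x i ^ 2) * (\<Sum>i\<in>I. y i ^ 3)"
      using that by (intro arg_cong2[where f = "(*)"] sum.cong)
        (auto simp: power_mult_distrib power2_eq_square power3_eq_cube)
    finally show ?thesis .
  qed
  have PQ: "P ^ 2 \<le> Q * S" and QP: "Q ^ 2 \<le> P * R"
    unfolding P_def Q_def R_def S_def using cs[of s r] cs[of r s] assms by auto
  have nn: "P \<ge> 0" "Q \<ge> 0" "R \<ge> 0" "S \<ge> 0"
    unfolding P_def Q_def R_def S_def using assms by (auto intro!: sum_nonneg)
  have "P * P ^ 3 = (P ^ 2) ^ 2" by (simp add: power2_eq_square power3_eq_cube)
  also have "\<dots> \<le> (Q * S) ^ 2" using PQ nn by (intro power_mono) auto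
  also have "\<dots> = Q ^ 2 * S ^ 2" by (rule power_mult_distrib)
  also have "\<dots> \<le> P * R * S ^ 2" using QP nn by (intro mult_right_mono) auto
  finally have "P * P ^ 3 \<le> P * (R * S ^ 2)" by (simp add: mult.assoc)
  then have "P ^ 3 \<le> R * S ^ 2"
    using nn by (cases "P = 0") auto
  then show ?thesis by (simp add: P_def R_def S_def)
qed

text \<open>Cauchy--Schwarz with weight \<open>r\<close> bounds the square by (sum r) * (sum r s^2);
  the cube of the second factor is then handled by Hoelder. This form exploits the first moment of
  \<open>r\<close> besides the third ones.\<close>

lemma sum_mult_power6_le:
  fixes r s :: "'a \<Rightarrow> real"
  assumes nn: "\<And>i. i \<in> I \<Longrightarrow> r i \<ge> 0" "\<And>i. i \<in> I \<Longrightarrow> s i \<ge> 0"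
  shows "(\<Sum>i\<in>I. r i * s i) ^ 6 \<le> (\<Sum>i\<in>I. r i) ^ 3 * (\<Sum>i\<in>I. r i ^ 3) * (\<Sum>i\<in>I. s i ^ 3) ^ 2"
proof -
  have "(\<Sum>i\<in>I. r i * s i) ^ 2 = (\<Sum>i\<in>I. sqrt (r i) * (sqrt (r i) * s i)) ^ 2"
    using nn by (intro arg_cong[where f = "\<lambda>x. x ^ 2"] sum.cong) (auto simp flip: mult.assoc)
  also have "\<dots> \<le> (\<Sum>i\<in>I. sqrt (r i) ^ 2) * (\<Sum>i\<in>I. (sqrt (r i) * s i) ^ 2)"
    by (rule Cauchy_Schwarz_ineq_sum)
  also have "\<dots> = (\<Sum>i\<in>I. r i) * (\<Sum>i\<in>I. r i * s i ^ 2)"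
    using nn by (intro arg_cong2[where f = "(*)"] sum.cong) (auto simp: power_mult_distrib)
  finally have "((\<Sum>i\<in>I. r i * s i) ^ 2) ^ 3 \<le> ((\<Sum>i\<in>I. r i) * (\<Sum>i\<in>I. r i * s i ^ 2)) ^ 3"
    by (intro power_mono) auto
  also have "\<dots> = (\<Sum>i\<in>I. r i) ^ 3 * (\<Sum>i\<in>I. r i * s i ^ 2) ^ 3" by (rule power_mult_distrib)
  also have "\<dots> \<le> (\<Sum>i\<in>I. r i) ^ 3 * ((\<Sum>i\<in>I. r i ^ 3) * (\<Sum>i\<in>I. s i ^ 3) ^ 2)"
    using nn by (intro mult_left_mono sum_mult_square_cubed_le zero_le_power sum_nonneg) auto
  finally show ?thesis by (simp add: mult.assoc flip: power_mult)
qed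

lemma card_square_le_collisions:
  assumes "finite T" "finite Q" "\<pi> ` T \<subseteq> Q"
  shows "card T ^ 2 \<le> card Q * card {(t, t'). t \<in> T \<and> t' \<in> T \<and> \<pi> t = \<pi> t'}"
proof -
  define F where "F = (\<lambda>q. {t \<in> T. \<pi> t = q})"
  have finF: "finite (F q)" for q using assms by (simp add: F_def)
  have "card T \<le> card (SIGMA q:Q. F q)"
    by (rule card_inj_on_le[where f = "\<lambda>t. (\<pi> t, t)"])
      (use assms finF in \<open>auto simp: inj_on_def F_def\<close>)
  also have "\<dots> = (\<Sum>q\<in>Q. card (F q))" using assms finF by (simp add: card_SigmaI)
  finally have "real (card T) \<le> (\<Sum>q\<in>Q. 1 * real (card (F q)))" by (simp flip: of_nat_sum)
  then have "real (card T) ^ 2 \<le> (\<Sum>q\<in>Q. 1 * real (card (F q))) ^ 2" by (intro power_mono) auto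
  also have "\<dots> \<le> (\<Sum>q\<in>Q. 1 ^ 2) * (\<Sum>q\<in>Q. real (card (F q)) ^ 2)" by (rule Cauchy_Schwarz_ineq_sum)
  also have "\<dots> = real (card Q * (\<Sum>q\<in>Q. card (F q \<times> F q)))"
    by (simp add: card_cartesian_product power2_eq_square)
  finally have 1: "card T ^ 2 \<le> card Q * (\<Sum>q\<in>Q. card (F q \<times> F q))"
    by (simp only: of_nat_power[symmetric] of_nat_le_iff)
  have "(\<Sum>q\<in>Q. card (F q \<times> F q)) = card (SIGMA q:Q. F q \<times> F q)"
    using assms finF by (simp add: card_SigmaI)
  also have "\<dots> \<le> card {(t, t'). t \<in> T \<and> t' \<in> T \<and> \<pi> t = \<pi> t'}"
  proof (rule card_inj_on_le[where f = snd])
    show "finite {(t, t'). t \<in> T \<and> t' \<in> T \<and> \<pi> t = \<pi> t'}"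
      by (rule finite_subset[of _ "T \<times> T"]) (use assms in auto)
  qed (auto simp: inj_on_def F_def)
  finally show ?thesis using 1 by (meson mult_le_mono2 order_trans)
qed

section \<open>Popular triples and popular pairs\<close>

text \<open>Triples (b, a, a') and (b2, a2, a2') with the same image satisfy b - b2 = a2 - a = a2' -
  a'. A collision is therefore a common difference z with one representation in B - B and two in A -
  A.\<close>

lemma triples_square_le:
  fixes A B G P D :: "real set"
  assumes fin: "finite A" "finite B" and GA: "G \<subseteq> A" and PS: "P \<subseteq> A + B"
  shows "card {(b, a, a'). b \<in> B \<and> a \<in> G \<and> a' \<in> G \<and> a - a' \<in> D \<and> a + b \<in> P} ^ 2
    \<le> card {(x, y). x \<in> P \<and> y \<in> A + B \<and> x - y \<in> D} * (\<Sum>z\<in>diff_set B B. rep_count B B z * rep_count A A z ^ 2)"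
proof -
  define T where "T = {(b, a, a'). b \<in> B \<and> a \<in> G \<and> a' \<in> G \<and> a - a' \<in> D \<and> a + b \<in> P}"
  define Q where "Q = {(x, y). x \<in> P \<and> y \<in> A + B \<and> x - y \<in> D}"
  define \<pi> where "\<pi> = (\<lambda>(b, a, a'). (a + b, a' + b) :: real \<times> real)"
  have finG: "finite G" using GA fin finite_subset by blast
  have finP: "finite P" using PS fin finite_set_plus finite_subset by metis
  have finT: "finite T"
    by (rule finite_subset[of _ "B \<times> G \<times> G"]) (use fin finG in \<open>auto simp: T_def\<close>)
  have finQ: "finite Q"
    by (rule finite_subset[of _ "P \<times> (A + B)"]) (use fin finP finite_set_plus in \<open>auto simp: Q_def\<close>)
  have "\<pi> ` T \<subseteq> Q"
    using GA by (auto simp: \<pi>_def T_def Q_def set_plus_def)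
  then have 1: "card T ^ 2 \<le> card Q * card {(t, t'). t \<in> T \<and> t' \<in> T \<and> \<pi> t = \<pi> t'}"
    by (rule card_square_le_collisions[OF finT finQ])
  define R where "R = (SIGMA z:diff_set B B. {b \<in> B. b - z \<in> B} \<times> {a \<in> A. a - z \<in> A} \<times> {a \<in> A. a - z \<in> A})"
  have finR: "finite R" unfolding R_def using fin by (intro finite_SigmaI) auto
  have "card {(t, t'). t \<in> T \<and> t' \<in> T \<and> \<pi> t = \<pi> t'} \<le> card R"
  proof (rule card_inj_on_le[where f = "\<lambda>((b, a, a'), (b2, a2, a2')). (b - b2, b, a2, a2')"])
    show "inj_on (\<lambda>((b, a, a'), (b2, a2, a2')). (b - b2, b, a2, a2')) {(t, t'). t \<in> T \<and> t' \<in> T \<and> \<pi> t = \<pi> t'}"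
      by (auto simp: inj_on_def \<pi>_def)
    show "(\<lambda>((b, a, a'), (b2, a2, a2')). (b - b2, b, a2, a2')) ` {(t, t'). t \<in> T \<and> t' \<in> T \<and> \<pi> t = \<pi> t'} \<subseteq> R"
    proof clarsimp
      fix b a a' b2 a2 a2'
      assume *: "(b, a, a') \<in> T" "(b2, a2, a2') \<in> T" "\<pi> (b, a, a') = \<pi> (b2, a2, a2')"
      then have "a2 - (b - b2) = a" "a2' - (b - b2) = a'" by (auto simp: \<pi>_def)
      then show "(b - b2, b, a2, a2') \<in> R"
        using * GA by (auto simp: R_def T_def diff_set_def subset_iff)
    qed
  qed (rule finR)
  also have "\<dots> = (\<Sum>z\<in>diff_set B B. rep_count B B z * rep_count A A z ^ 2)"
    unfolding R_def using fin
    by (subst card_SigmaI) (auto simp: card_cartesian_product rep_count_def power2_eq_square)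
  finally show ?thesis using 1 unfolding T_def Q_def by (meson mult_le_mono2 order_trans)
qed

text \<open>The dependence on card X is the one that the incidence estimate delivers;
  \<open>k\<close> is real because it arises as a quotient by a cubic energy.\<close>

definition cubic_moment_bound :: "real \<Rightarrow> real set \<Rightarrow> bool"
  where "cubic_moment_bound k A \<longleftrightarrow> (\<forall>X. finite X \<longrightarrow> real (rep_moment 3 A X) \<le> k * real (card X) ^ 2)"

lemma cubic_moment_bound_subset:
  assumes "cubic_moment_bound k A" "finite A" "A' \<subseteq> A"
  shows "cubic_moment_bound k A'"
  unfolding cubic_moment_bound_def
proof (intro allI impI)
  fix X :: "real set" assume "finite X"
  then have "rep_moment 3 A' X \<le> rep_moment 3 A X" "real (rep_moment 3 A X) \<le> k * real (card X) ^ 2"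
    using assms rep_moment_mono[of A X A' X 3] by (auto simp: cubic_moment_bound_def)
  then show "real (rep_moment 3 A' X) \<le> k * real (card X) ^ 2" by linarith
qed

lemma collision_cubed_le:
  assumes fin: "finite A" "finite B"
  shows "real (\<Sum>z\<in>diff_set B B. rep_count B B z * rep_count A A z ^ 2) ^ 3 \<le> real (rep_moment 3 B B) * real (rep_moment 3 A A) ^ 2"
proof -
  have "real (\<Sum>z\<in>diff_set B B. rep_count B B z * rep_count A A z ^ 2) ^ 3 = (\<Sum>z\<in>diff_set B B. real (rep_count B B z) * real (rep_count A A z) ^ 2) ^ 3"
    by simp
  also have "\<dots> \<le> (\<Sum>z\<in>diff_set B B. real (rep_count B B z) ^ 3) * (\<Sum>z\<in>diff_set B B. real (rep_count A A z) ^ 3) ^ 2"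
    by (rule sum_mult_square_cubed_le) auto
  also have "\<dots> = real (rep_moment 3 B B) * real (\<Sum>z\<in>diff_set B B. rep_count A A z ^ 3) ^ 2"
    by (simp add: rep_moment_def)
  also have "\<dots> \<le> real (rep_moment 3 B B) * real (rep_moment 3 A A) ^ 2"
    using fin by (intro mult_left_mono power_mono of_nat_mono sum_rep_count_le_rep_moment) (auto intro: sum_nonneg)
  finally show ?thesis .
qed

text \<open>Write x = a + b in one of at least w / m ways. Then z = a - (x - y) is represented in A
  - D, and z = y - b shows that -z is represented in B - (A + B). Summing the product of the two
  representation functions over z brings in both moment hypotheses.\<close>

lemma popular_pairs_le:
  fixes A B P D :: "real set"
  assumes fin: "finite A" "finite B" "finite D" and PS: "P \<subseteq> A + B"
    and pop: "\<And>x. x \<in> P \<Longrightarrow> w \<le> m * card {a \<in> A. x - a \<in> B}"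
    and kA: "cubic_moment_bound kA A" and kB: "cubic_moment_bound kB B"
  shows "(real w * real (card {(x, y). x \<in> P \<and> y \<in> A + B \<and> x - y \<in> D})) ^ 6
    \<le> real m ^ 6 * ((real (card A) * real (card D)) ^ 3 * (kA * real (card D) ^ 2) * (kB * real (card (A + B)) ^ 2) ^ 2)"
proof -
  define Q where "Q = {(x, y). x \<in> P \<and> y \<in> A + B \<and> x - y \<in> D}"
  define S where "S = A + B"
  have finS: "finite S" unfolding S_def using fin by (simp add: finite_set_plus)
  have finP: "finite P" using PS finS finite_subset unfolding S_def by metis
  have finQ: "finite Q"
    by (rule finite_subset[of _ "P \<times> S"]) (use finP finS in \<open>auto simp: Q_def S_def\<close>)
  define W where "W = (\<Sum>z\<in>diff_set A D. rep_count A D z * rep_count B S (- z))"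
  define R where "R = (SIGMA z:diff_set A D. {a \<in> A. a - z \<in> D} \<times> {b \<in> B. b - (- z) \<in> S})"
  define U where "U = (SIGMA q:Q. {a \<in> A. fst q - a \<in> B})"
  have finR: "finite R" unfolding R_def using fin by (intro finite_SigmaI) auto
  have "card U \<le> card R"
  proof (rule card_inj_on_le[where f = "\<lambda>((x, y), a). (a - x + y, a, x - a)"])
    show "inj_on (\<lambda>((x, y), a). (a - x + y, a, x - a)) U" by (auto simp: inj_on_def)
    show "(\<lambda>((x, y), a). (a - x + y, a, x - a)) ` U \<subseteq> R"
    proof clarsimp
      fix x y a assume *: "((x, y), a) \<in> U"
      have "a - x + y = a - (x - y)" by simp
      then have "a - x + y \<in> diff_set A D" using * unfolding U_def Q_def diff_set_def by force
      then show "(a - x + y, a, x - a) \<in> R" using * by (auto simp: R_def U_def Q_def S_def)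
    qed
  qed (rule finR)
  also have "card R = W"
    unfolding R_def W_def using fin by (subst card_SigmaI) (auto simp: card_cartesian_product rep_count_def)
  finally have UW: "card U \<le> W" .
  have "w * card Q = (\<Sum>q\<in>Q. w)" by simp
  also have "\<dots> \<le> (\<Sum>q\<in>Q. m * card {a \<in> A. fst q - a \<in> B})"
    by (intro sum_mono pop) (auto simp: Q_def)
  also have "\<dots> = m * card U"
    unfolding U_def using finQ fin by (subst card_SigmaI) (auto simp: sum_distrib_left)
  also have "\<dots> \<le> m * W" using UW by simp
  finally have wQ: "w * card Q \<le> m * W" .
  have "real W ^ 6 = (\<Sum>z\<in>diff_set A D. real (rep_count A D z) * real (rep_count B S (- z))) ^ 6"
    by (simp add: W_def)
  also have "\<dots> \<le> (\<Sum>z\<in>diff_set A D. real (rep_count A D z)) ^ 3 * (\<Sum>z\<in>diff_set A D. real (rep_count A D z) ^ 3)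
      * (\<Sum>z\<in>diff_set A D. real (rep_count B S (- z)) ^ 3) ^ 2"
    by (rule sum_mult_power6_le) auto
  also have "\<dots> \<le> (real (card A) * real (card D)) ^ 3 * (kA * real (card D) ^ 2) * (kB * real (card S) ^ 2) ^ 2"
  proof (intro mult_mono power_mono)
    show "(\<Sum>z\<in>diff_set A D. real (rep_count A D z)) \<le> real (card A) * real (card D)"
      using sum_rep_count[of "diff_set A D" A D] fin by (simp flip: of_nat_sum of_nat_mult)
    show kA': "(\<Sum>z\<in>diff_set A D. real (rep_count A D z) ^ 3) \<le> kA * real (card D) ^ 2"
      using kA fin unfolding cubic_moment_bound_def by (simp add: rep_moment_def)
    show "0 \<le> (real (card A) * real (card D)) ^ 3 * (kA * real (card D) ^ 2)"
      by (intro mult_nonneg_nonneg order.trans[OF _ kA'] sum_nonneg) auto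
    have "(\<Sum>z\<in>diff_set A D. rep_count B S (- z) ^ 3) = (\<Sum>z\<in>uminus ` diff_set A D. rep_count B S z ^ 3)"
      by (simp add: sum.reindex)
    also have "\<dots> \<le> rep_moment 3 B S" using fin finS by (intro sum_rep_count_le_rep_moment) auto
    finally have "real (\<Sum>z\<in>diff_set A D. rep_count B S (- z) ^ 3) \<le> real (rep_moment 3 B S)" by (rule of_nat_mono)
    also have "\<dots> \<le> kB * real (card S) ^ 2" using kB finS by (auto simp: cubic_moment_bound_def)
    finally show "(\<Sum>z\<in>diff_set A D. real (rep_count B S (- z)) ^ 3) \<le> kB * real (card S) ^ 2" by simp
  qed (auto intro!: sum_nonneg)
  finally have W6: "real W ^ 6 \<le> (real (card A) * real (card D)) ^ 3 * (kA * real (card D) ^ 2) * (kB * real (card S) ^ 2) ^ 2" .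
  have "(real w * real (card Q)) ^ 6 \<le> (real m * real W) ^ 6"
    using of_nat_mono[OF wQ, where 'a = real] by (intro power_mono) auto
  also have "\<dots> = real m ^ 6 * real W ^ 6" by (rule power_mult_distrib)
  also have "\<dots> \<le> real m ^ 6 * ((real (card A) * real (card D)) ^ 3 * (kA * real (card D) ^ 2) * (kB * real (card S) ^ 2) ^ 2)"
    using W6 by (intro mult_left_mono) auto
  finally show ?thesis unfolding Q_def S_def .
qed

text \<open>Each sum outside \<open>P\<close> has fewer representations than the threshold, so
  together these sums account for at most card A * card B / (4 L) pairs, while every element of
  \<open>bad\<close> uses more than card B / 2 of them. The resulting fraction 1/(2 L) is the one
  allowed by \<open>stable_under_deletion\<close>.\<close>

lemma few_unpopular_elements:
  fixes A B :: "real set" and L :: nat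
  assumes fin: "finite A" "finite B" and ne: "A \<noteq> {}" "B \<noteq> {}"
  defines "P \<equiv> {x \<in> A + B. card A * card B \<le> 4 * L * card (A + B) * card {a \<in> A. x - a \<in> B}}"
  defines "bad \<equiv> {a \<in> A. card B < 2 * card {b \<in> B. a + b \<notin> P}}"
  shows "2 * L * card bad \<le> card A"
proof -
  define S where "S = A + B"
  have finS: "finite S" unfolding S_def using fin by (simp add: finite_set_plus)
  have sB: "card S > 0" "card B > 0"
    using finS ne fin by (auto simp: card_gt_0_iff S_def set_plus_def)
  have finbad: "finite bad" using fin by (simp add: bad_def)
  define U where "U = (SIGMA a:bad. {b \<in> B. a + b \<notin> P})"
  define R where "R = (SIGMA x:S - P. {a \<in> A. x - a \<in> B})"
  have finR: "finite R" unfolding R_def using fin finS by (intro finite_SigmaI) auto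
  have UR: "card U \<le> card R"
  proof (rule card_inj_on_le[where f = "\<lambda>(a, b). (a + b, a)"])
    show "inj_on (\<lambda>(a, b). (a + b, a)) U" by (auto simp: inj_on_def)
    show "(\<lambda>(a, b). (a + b, a)) ` U \<subseteq> R" by (auto simp: U_def R_def S_def bad_def set_plus_def)
  qed (rule finR)
  have "card B * card bad = (\<Sum>a\<in>bad. card B)" by simp
  also have "\<dots> \<le> (\<Sum>a\<in>bad. 2 * card {b \<in> B. a + b \<notin> P})"
    by (intro sum_mono) (auto simp: bad_def)
  also have "\<dots> = 2 * card U"
    unfolding U_def using finbad fin by (subst card_SigmaI) (auto simp: sum_distrib_left)
  finally have bU: "card B * card bad \<le> 2 * card U" .
  have "4 * L * card S * card R = (\<Sum>x\<in>S - P. 4 * L * card S * card {a \<in> A. x - a \<in> B})"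
    unfolding R_def using finS fin by (subst card_SigmaI) (auto simp: sum_distrib_left)
  also have "\<dots> \<le> (\<Sum>x\<in>S - P. card A * card B)"
    by (intro sum_mono) (auto simp: P_def S_def)
  also have "\<dots> \<le> card S * (card A * card B)"
    using finS by (auto intro!: mult_right_mono card_mono)
  finally have "card S * (4 * L * card R) \<le> card S * (card A * card B)" by (simp only: mult_ac)
  then have "4 * L * card R \<le> card A * card B" using sB by simp
  moreover have "4 * L * card U \<le> 4 * L * card R" using UR by simp
  moreover have "2 * L * (card B * card bad) \<le> 2 * L * (2 * card U)" using bU by (intro mult_left_mono) auto
  ultimately have "2 * L * (card B * card bad) \<le> card A * card B" by linarith
  then have "card B * (2 * L * card bad) \<le> card B * card A" by (simp only: mult_ac)
  then show ?thesis using sB by simp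
qed

text \<open>By stability, removing \<open>bad\<close> keeps half of the additive energy, so one
  dyadic level D of G - G still carries it. Each d in D has at least \<open>\<Delta>\<close>
  representations a - a' in G, and each such \<open>a\<close> forms popular sums with at least half
  of \<open>B\<close>.\<close>

lemma many_popular_triples:
  fixes A B :: "real set"
  assumes fin: "finite A" "finite B" and ne: "A \<noteq> {}" "B \<noteq> {}"
    and L: "L \<ge> 8" "card A ^ 4 \<le> 2 ^ L"
    and stable: "stable_under_deletion L (\<lambda>A. rep_moment 2 A A) A"
  obtains G P D \<Delta> where "G \<subseteq> A" "P \<subseteq> A + B" "finite D"
    "\<forall>x\<in>P. card A * card B \<le> (4 * L * card (A + B)) * card {a \<in> A. x - a \<in> B}"
    "rep_moment 2 A A \<le> 8 * L * \<Delta> ^ 2 * card D" "card D * \<Delta> ^ 3 \<le> rep_moment 3 A A"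
    "card B * card D * \<Delta> \<le> 2 * card {(b, a, a'). b \<in> B \<and> a \<in> G \<and> a' \<in> G \<and> a - a' \<in> D \<and> a + b \<in> P}"
proof -
  define P where "P = {x \<in> A + B. card A * card B \<le> 4 * L * card (A + B) * card {a \<in> A. x - a \<in> B}}"
  define bad where "bad = {a \<in> A. card B < 2 * card {b \<in> B. a + b \<notin> P}}"
  have few: "2 * L * card bad \<le> card A"
    unfolding bad_def P_def by (rule few_unpopular_elements[OF fin ne])
  define G where "G = A - bad"
  have GA: "G \<subseteq> A" by (auto simp: G_def)
  have finG: "finite G" using fin by (simp add: G_def)
  have "A - G = bad" by (auto simp: G_def bad_def)
  then have E: "rep_moment 2 A A \<le> 2 * rep_moment 2 G G"
    using stable few GA unfolding stable_under_deletion_def by auto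
  have rdL: "rep_count G G z < 2 ^ L" for z
  proof -
    have "rep_count G G z \<le> card A" using rep_count_le_card[OF finG] card_mono[OF fin(1) GA] by (meson order_trans)
    then show ?thesis using less_two_power[of "card A" L] L by linarith
  qed
  obtain j where j: "rep_moment 2 G G \<le> L * 2 ^ 2 * (2 ^ j) ^ 2 *
      card {z \<in> diff_set G G. 2 ^ j \<le> rep_count G G z \<and> rep_count G G z < 2 ^ Suc j}"
    unfolding rep_moment_def
    using dyadic_pigeonhole[of "diff_set G G" "rep_count G G" L 2, OF _ rdL] finG L(1) by auto
  define D where "D = {z \<in> diff_set G G. 2 ^ j \<le> rep_count G G z \<and> rep_count G G z < 2 ^ Suc j}"
  define \<Delta> :: nat where "\<Delta> = 2 ^ j"
  have finD: "finite D" using finG by (simp add: D_def)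
  have rdD: "\<Delta> \<le> rep_count G G d" if "d \<in> D" for d using that by (auto simp: D_def \<Delta>_def)
  define T where "T = {(b, a, a'). b \<in> B \<and> a \<in> G \<and> a' \<in> G \<and> a - a' \<in> D \<and> a + b \<in> P}"
  have finT: "finite T"
    by (rule finite_subset[of _ "B \<times> G \<times> G"]) (use fin finG in \<open>auto simp: T_def\<close>)
  have half: "card B \<le> 2 * card {b \<in> B. a + b \<in> P}" if "a \<in> G" for a
  proof -
    have "2 * card {b \<in> B. a + b \<notin> P} \<le> card B" using that by (auto simp: G_def bad_def)
    moreover have "card B = card {b \<in> B. a + b \<in> P} + card {b \<in> B. a + b \<notin> P}"
      using fin by (subst card_Un_disjoint[symmetric]) (auto intro!: arg_cong[where f = card])
    ultimately show ?thesis by linarith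
  qed
  define R where "R = (SIGMA d:D. SIGMA a:{a \<in> G. a - d \<in> G}. {b \<in> B. a + b \<in> P})"
  have "card R \<le> card T"
  proof (rule card_inj_on_le[where f = "\<lambda>(d, a, b). (b, a, a - d)"])
    show "inj_on (\<lambda>(d, a, b). (b, a, a - d)) R" by (auto simp: inj_on_def)
    show "(\<lambda>(d, a, b). (b, a, a - d)) ` R \<subseteq> T" by (auto simp: R_def T_def)
  qed (rule finT)
  moreover have "card B * card D * \<Delta> \<le> 2 * card R"
  proof -
    have "card B * card D * \<Delta> = (\<Sum>d\<in>D. \<Delta> * card B)" by simp
    also have "\<dots> \<le> (\<Sum>d\<in>D. rep_count G G d * card B)" using rdD by (intro sum_mono mult_right_mono) auto
    also have "\<dots> = (\<Sum>d\<in>D. \<Sum>a\<in>{a \<in> G. a - d \<in> G}. card B)" by (simp add: rep_count_def)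
    also have "\<dots> \<le> (\<Sum>d\<in>D. \<Sum>a\<in>{a \<in> G. a - d \<in> G}. 2 * card {b \<in> B. a + b \<in> P})"
      using half by (intro sum_mono) auto
    also have "\<dots> = 2 * card R"
      unfolding R_def using finD finG fin by (simp add: card_SigmaI sum_distrib_left)
    finally show ?thesis .
  qed
  ultimately have count: "card B * card D * \<Delta> \<le> 2 * card T" by linarith
  have "card D * \<Delta> ^ 3 = (\<Sum>d\<in>D. \<Delta> ^ 3)" by simp
  also have "\<dots> \<le> (\<Sum>d\<in>D. rep_count G G d ^ 3)" using rdD by (intro sum_mono power_mono) auto
  also have "\<dots> \<le> rep_moment 3 G G" using finD finG by (intro sum_rep_count_le_rep_moment) auto
  also have "\<dots> \<le> rep_moment 3 A A" using fin GA by (intro rep_moment_mono) auto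
  finally have D3: "card D * \<Delta> ^ 3 \<le> rep_moment 3 A A" .
  have "rep_moment 2 G G \<le> 4 * L * \<Delta> ^ 2 * card D" using j unfolding D_def \<Delta>_def by (simp add: mult_ac)
  then have E2: "rep_moment 2 A A \<le> 8 * L * \<Delta> ^ 2 * card D" using E by linarith
  show ?thesis
    by (rule that[OF GA _ finD _ E2 D3 count[unfolded T_def]]) (auto simp: P_def)
qed

text \<open>
  With \<open>T\<close> the popular triples \<open>(b, a, a')\<close> and \<open>Q\<close> the pairs \<open>(a + b, a' + b)\<close>, Cauchy--Schwarz gives
  \<open>T\<^sup>2 \<le> Q \<Sum> r\<^sub>B r\<^sub>A\<^sup>2\<close>, and \<open>Q\<close> is bounded by third moments after writing its first entry
  as a popular sum.
\<close>

lemma energy_half_chain: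
  fixes A B :: "real set"
  assumes fin: "finite A" "finite B" and ne: "A \<noteq> {}" "B \<noteq> {}"
    and L: "L \<ge> 8" "card A ^ 4 \<le> 2 ^ L"
    and stable: "stable_under_deletion L (\<lambda>A. rep_moment 2 A A) A"
    and kA: "cubic_moment_bound kA A" "kA \<ge> 0" and kB: "cubic_moment_bound kB B" "kB \<ge> 0"
  shows "real (card B) ^ 18 * real (card A) ^ 3 * real (rep_moment 2 A A) ^ 9
    \<le> real L ^ 32 * real (card (A + B)) ^ 10 * kB ^ 2 * kA * real (rep_moment 3 B B) ^ 2 * real (rep_moment 3 A A) ^ 6"
proof -
  obtain G P D \<Delta> where *: "G \<subseteq> A" "P \<subseteq> A + B" "finite D"
    and pop: "\<forall>x\<in>P. card A * card B \<le> (4 * L * card (A + B)) * card {a \<in> A. x - a \<in> B}"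
    and E: "rep_moment 2 A A \<le> 8 * L * \<Delta> ^ 2 * card D" and D3: "card D * \<Delta> ^ 3 \<le> rep_moment 3 A A"
    and T: "card B * card D * \<Delta> \<le> 2 * card {(b, a, a'). b \<in> B \<and> a \<in> G \<and> a' \<in> G \<and> a - a' \<in> D \<and> a + b \<in> P}"
    by (rule many_popular_triples[OF fin ne L stable])
  define t where "t = real (card {(b, a, a'). b \<in> B \<and> a \<in> G \<and> a' \<in> G \<and> a - a' \<in> D \<and> a + b \<in> P})"
  define q where "q = real (card {(x, y). x \<in> P \<and> y \<in> A + B \<and> x - y \<in> D})"
  define c where "c = real (\<Sum>z\<in>diff_set B B. rep_count B B z * rep_count A A z ^ 2)"
  define a where "a = real (card A)"
  define b where "b = real (card B)"
  define d where "d = real (card D)"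
  define s where "s = real (card (A + B))"
  define l where "l = real L"
  define e where "e = real (rep_moment 2 A A)"
  define eA where "eA = real (rep_moment 3 A A)"
  define eB where "eB = real (rep_moment 3 B B)"
  define \<delta> where "\<delta> = real \<Delta>"
  have nn: "t \<ge> 0" "q \<ge> 0" "c \<ge> 0" "a > 0" "b > 0" "d \<ge> 0" "s \<ge> 0" "l \<ge> 8" "eA \<ge> 0" "eB \<ge> 0" "\<delta> \<ge> 0" "e > 0"
    unfolding t_def q_def c_def a_def b_def d_def s_def l_def e_def eA_def eB_def \<delta>_def
    using fin ne L rep_moment_pos[OF fin(1) ne(1), of 2] by (auto simp: card_gt_0_iff intro!: sum_nonneg)
  have "e \<le> real (8 * L * \<Delta> ^ 2 * card D)" unfolding e_def using E by (rule of_nat_mono)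
  then have E': "e \<le> 8 * l * (\<delta> ^ 2 * d)" by (simp add: l_def \<delta>_def d_def mult_ac)
  have dpos: "d > 0" "\<delta> > 0" using E' nn by (auto simp: less_le)
  have D3': "d * \<delta> ^ 3 \<le> eA" using of_nat_mono[OF D3, where 'a = real] by (simp add: d_def \<delta>_def eA_def)
  have T': "b * d * \<delta> \<le> 2 * t" using of_nat_mono[OF T, where 'a = real] by (simp add: b_def d_def \<delta>_def t_def)
  have "t ^ 2 \<le> q * c"
    using of_nat_mono[OF triples_square_le[OF fin *(1,2), of D], where 'a = real]
    unfolding t_def q_def c_def by (simp only: of_nat_mult of_nat_power)
  have c3: "c ^ 3 \<le> eB * eA ^ 2" unfolding c_def eA_def eB_def by (rule collision_cubed_le[OF fin])
  have q6: "(a * b * q) ^ 6 \<le> (4 * l * s) ^ 6 * ((a * d) ^ 3 * (kA * d ^ 2) * (kB * s ^ 2) ^ 2)"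
    using popular_pairs_le[OF fin *(3,2) bspec[OF pop] kA(1) kB(1)]
    unfolding a_def b_def q_def l_def s_def d_def by simp
  \<comment> \<open>The 12th power makes t^2 \<le> q c into q^6 c^6, where q^6 is the power bounded
    by \<open>q6\<close> and c^6 is the square of what \<open>c3\<close> bounds.\<close>
  have "(b * d * \<delta>) ^ 12 \<le> (2 * t) ^ 12" using T' nn dpos by (intro power_mono) auto
  also have "\<dots> = 2 ^ 12 * (t ^ 2) ^ 6" by (simp add: power_mult_distrib flip: power_mult)
  also have "\<dots> \<le> 2 ^ 12 * (q * c) ^ 6"
    using \<open>t ^ 2 \<le> q * c\<close> nn by (intro mult_left_mono power_mono) auto
  also have "\<dots> = 2 ^ 12 * q ^ 6 * (c ^ 3) ^ 2" by (simp add: power_mult_distrib flip: power_mult)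
  also have "\<dots> \<le> 2 ^ 12 * q ^ 6 * (eB * eA ^ 2) ^ 2"
    using c3 nn by (intro mult_left_mono power_mono) auto
  finally have "(a * b) ^ 6 * (b * d * \<delta>) ^ 12 \<le> (a * b) ^ 6 * (2 ^ 12 * q ^ 6 * (eB * eA ^ 2) ^ 2)"
    using nn by (intro mult_left_mono) auto
  also have "\<dots> = 2 ^ 12 * (a * b * q) ^ 6 * (eB * eA ^ 2) ^ 2" by (simp add: power_mult_distrib mult_ac)
  also have "\<dots> \<le> 2 ^ 12 * ((4 * l * s) ^ 6 * ((a * d) ^ 3 * (kA * d ^ 2) * (kB * s ^ 2) ^ 2)) * (eB * eA ^ 2) ^ 2"
    using q6 nn by (intro mult_left_mono mult_right_mono) auto
  finally have "(a * b) ^ 6 * (b * d * \<delta>) ^ 12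
    \<le> 2 ^ 12 * ((4 * l * s) ^ 6 * ((a * d) ^ 3 * (kA * d ^ 2) * (kB * s ^ 2) ^ 2)) * (eB * eA ^ 2) ^ 2" .
  also have "(a * b) ^ 6 * (b * d * \<delta>) ^ 12 = (a ^ 3 * d ^ 5) * (b ^ 18 * a ^ 3 * (d ^ 7 * \<delta> ^ 12))"
    by (simp add: power_mult_distrib eval_nat_numeral)
  also have "2 ^ 12 * ((4 * l * s) ^ 6 * ((a * d) ^ 3 * (kA * d ^ 2) * (kB * s ^ 2) ^ 2)) * (eB * eA ^ 2) ^ 2
     = (a ^ 3 * d ^ 5) * (8 ^ 8 * l ^ 6 * s ^ 10 * kA * kB ^ 2 * eB ^ 2 * eA ^ 4)"
    by (simp add: power_mult_distrib eval_nat_numeral)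
  finally have main: "b ^ 18 * a ^ 3 * (d ^ 7 * \<delta> ^ 12) \<le> 8 ^ 8 * l ^ 6 * s ^ 10 * kA * kB ^ 2 * eB ^ 2 * eA ^ 4"
    using nn dpos by (simp add: mult_le_cancel_left)
  \<comment> \<open>The 9th power fits because (\<delta>^2 d)^9 = (d^7 \<delta>^12) (d
    \<delta>^3)^2: the first factor is what \<open>main\<close> controls, the second is at most
    eA^2.\<close>
  have "e ^ 9 \<le> (8 * l * (\<delta> ^ 2 * d)) ^ 9" using E' nn by (intro power_mono) auto
  also have "\<dots> = (8 ^ 9 * l ^ 9 * (d ^ 7 * \<delta> ^ 12)) * (d * \<delta> ^ 3) ^ 2"
    by (simp add: power_mult_distrib eval_nat_numeral)
  also have "\<dots> \<le> (8 ^ 9 * l ^ 9 * (d ^ 7 * \<delta> ^ 12)) * eA ^ 2"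
    using D3' nn dpos by (intro mult_left_mono power_mono) auto
  finally have "b ^ 18 * a ^ 3 * e ^ 9 \<le> b ^ 18 * a ^ 3 * ((8 ^ 9 * l ^ 9 * (d ^ 7 * \<delta> ^ 12)) * eA ^ 2)"
    using nn by (intro mult_left_mono) auto
  also have "\<dots> = (b ^ 18 * a ^ 3 * (d ^ 7 * \<delta> ^ 12)) * (8 ^ 9 * l ^ 9 * eA ^ 2)" by (simp only: mult_ac)
  also have "\<dots> \<le> (8 ^ 8 * l ^ 6 * s ^ 10 * kA * kB ^ 2 * eB ^ 2 * eA ^ 4) * (8 ^ 9 * l ^ 9 * eA ^ 2)"
    using main nn by (intro mult_right_mono) auto
  also have "\<dots> = 8 ^ 17 * (l ^ 15 * s ^ 10 * kB ^ 2 * kA * eB ^ 2 * eA ^ 6)"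
    by (simp add: eval_nat_numeral)
  also have "\<dots> \<le> l ^ 17 * (l ^ 15 * s ^ 10 * kB ^ 2 * kA * eB ^ 2 * eA ^ 6)"
    using nn kA(2) kB(2) by (intro mult_right_mono power_mono) auto
  also have "\<dots> = l ^ 32 * s ^ 10 * kB ^ 2 * kA * eB ^ 2 * eA ^ 6"
    by (simp flip: mult.assoc power_add)
  finally show ?thesis unfolding a_def b_def e_def l_def s_def eA_def eB_def .
qed

section \<open>Elimination of the additive energies\<close>

text \<open>Cauchy--Schwarz over the sums counts the solutions of a + b = a2 + b2; grouped by a - a2
  = b2 - b, a second Cauchy--Schwarz separates the two additive energies.\<close>

lemma energy_product_ge:
  fixes A B :: "real set"
  assumes fin: "finite A" "finite B"
  shows "(card A * card B) ^ 4 \<le> card (A + B) ^ 2 * (rep_moment 2 A A * rep_moment 2 B B)"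
proof -
  define c where "c = (\<Sum>z\<in>diff_set A A. rep_count A A z * rep_count B B z)"
  define Col where "Col = {(t, t'). t \<in> A \<times> B \<and> t' \<in> A \<times> B \<and>
    (\<lambda>(a, b). a + b) t = (\<lambda>(a, b). a + b) t'}"
  define R where "R = (SIGMA z:diff_set A A. {a \<in> A. a - z \<in> A} \<times> {b \<in> B. b - z \<in> B})"
  have "card (A \<times> B) ^ 2 \<le> card (A + B) * card Col"
    unfolding Col_def using fin
    by (intro card_square_le_collisions) (auto simp: finite_set_plus set_plus_def)
  moreover have "card Col \<le> card R"
  proof (rule card_inj_on_le[where f = "\<lambda>((a, b), (a2, b2)). (a - a2, a, b2)"])
    show "finite R" unfolding R_def using fin by (intro finite_SigmaI) auto
    show "inj_on (\<lambda>((a, b), (a2, b2)). (a - a2, a, b2)) Col"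
      by (auto simp: inj_on_def Col_def)
    show "(\<lambda>((a, b), (a2, b2)). (a - a2, a, b2)) ` Col \<subseteq> R"
    proof clarsimp
      fix a b a2 b2 assume *: "((a, b), (a2, b2)) \<in> Col"
      then have "b2 - (a - a2) = b" by (auto simp: Col_def)
      then show "(a - a2, a, b2) \<in> R" using * by (auto simp: R_def Col_def diff_set_def)
    qed
  qed
  moreover have "card R = c"
    unfolding R_def c_def using fin by (subst card_SigmaI) (auto simp: card_cartesian_product rep_count_def)
  ultimately have "(card A * card B) ^ 2 \<le> card (A + B) * c"
    by (simp add: card_cartesian_product) (meson mult_le_mono2 order_trans)
  then have "((card A * card B) ^ 2) ^ 2 \<le> (card (A + B) * c) ^ 2" by (rule power_mono) simp
  moreover have "c ^ 2 \<le> rep_moment 2 A A * rep_moment 2 B B"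
  proof -
    have "real (c ^ 2) = (\<Sum>z\<in>diff_set A A. real (rep_count A A z) * real (rep_count B B z)) ^ 2" by (simp add: c_def)
    also have "\<dots> \<le> (\<Sum>z\<in>diff_set A A. real (rep_count A A z) ^ 2) * (\<Sum>z\<in>diff_set A A. real (rep_count B B z) ^ 2)"
      by (rule Cauchy_Schwarz_ineq_sum)
    also have "\<dots> = real (rep_moment 2 A A * (\<Sum>z\<in>diff_set A A. rep_count B B z ^ 2))" by (simp add: rep_moment_def)
    finally have "c ^ 2 \<le> rep_moment 2 A A * (\<Sum>z\<in>diff_set A A. rep_count B B z ^ 2)" by (simp only: of_nat_le_iff)
    also have "\<dots> \<le> rep_moment 2 A A * rep_moment 2 B B" using fin by (intro mult_left_mono sum_rep_count_le_rep_moment) auto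
    finally show ?thesis .
  qed
  ultimately show ?thesis
    by (simp add: power_mult_distrib flip: power_mult) (meson mult_le_mono2 order_trans)
qed

lemma exists_energy_stable_subset:
  assumes fin: "finite A" "A \<noteq> {}" and L: "L > 0" "card A ^ 4 \<le> 2 ^ L"
  obtains A' where "A' \<subseteq> A" "A' \<noteq> {}" "card A \<le> 2 * card A'"
    "stable_under_deletion L (\<lambda>A. rep_moment 2 A A) A'"
proof -
  have "\<exists>A'\<subseteq>A. A' \<noteq> {} \<and> card A \<le> 2 * card A' \<and> stable_under_deletion L (\<lambda>A. rep_moment 2 A A) A'"
  proof (rule exists_stable_subset[OF fin L(1)])
    show "1 \<le> rep_moment 2 A' A'" if "A' \<subseteq> A" "A' \<noteq> {}" for A'
      using that fin finite_subset by (intro rep_moment_pos) auto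
    have "rep_moment 2 A A \<le> card A ^ 2 * card A"
      using rep_moment_le[of A A 1] fin by (simp add: numeral_2_eq_2)
    also have "\<dots> = card A ^ 3" by (simp add: power3_eq_cube power2_eq_square)
    also have "\<dots> \<le> card A ^ 4" using fin by (intro power_increasing) (auto simp: Suc_le_eq card_gt_0_iff)
    finally show "rep_moment 2 A A \<le> 2 ^ L" using L by linarith
  qed
  then show ?thesis using that by blast
qed

text \<open>The half chain bounds either additive energy from above in terms of cubic ones, and
  \<open>energy_product_ge\<close> bounds their product from below. Stability is needed only inside;
  monotonicity of the third moments leads back to \<open>A\<close> and \<open>B\<close>.\<close>

lemma energy_chain:
  fixes A B :: "real set"
  assumes fin: "finite A" "finite B" and ne: "A \<noteq> {}" "B \<noteq> {}"
    and L: "L \<ge> 8" "card A ^ 4 \<le> 2 ^ L" "card B ^ 4 \<le> 2 ^ L"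
    and kA: "cubic_moment_bound kA A" "kA \<ge> 0" and kB: "cubic_moment_bound kB B" "kB \<ge> 0"
  shows "(real (card A) * real (card B)) ^ 57
    \<le> real L ^ 102 * real (card (A + B)) ^ 38 * (kA * kB) ^ 3 * (real (rep_moment 3 A A) * real (rep_moment 3 B B)) ^ 8"
proof -
  have L0: "L > 0" using L by simp
  obtain A' where A': "A' \<subseteq> A" "A' \<noteq> {}" "card A \<le> 2 * card A'"
    "stable_under_deletion L (\<lambda>A. rep_moment 2 A A) A'"
    by (rule exists_energy_stable_subset[OF fin(1) ne(1) L0 L(2)])
  obtain B' where B': "B' \<subseteq> B" "B' \<noteq> {}" "card B \<le> 2 * card B'"
    "stable_under_deletion L (\<lambda>A. rep_moment 2 A A) B'"
    by (rule exists_energy_stable_subset[OF fin(2) ne(2) L0 L(3)])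
  have fin': "finite A'" "finite B'" using A' B' fin finite_subset by auto
  have le4: "card A' ^ 4 \<le> 2 ^ L" "card B' ^ 4 \<le> 2 ^ L"
  proof -
    have "card A' ^ 4 \<le> card A ^ 4" "card B' ^ 4 \<le> card B ^ 4"
      using fin A' B' by (auto intro!: power_mono card_mono)
    then show "card A' ^ 4 \<le> 2 ^ L" "card B' ^ 4 \<le> 2 ^ L" using L(2,3) by linarith+
  qed
  note k' = cubic_moment_bound_subset[OF kA(1) fin(1) A'(1)] cubic_moment_bound_subset[OF kB(1) fin(2) B'(1)]
  define a where "a = real (card A')"
  define b where "b = real (card B')"
  define s where "s = real (card (A' + B'))"
  define l where "l = real L"
  define eA where "eA = real (rep_moment 2 A' A')"
  define eB where "eB = real (rep_moment 2 B' B')"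
  define tA where "tA = real (rep_moment 3 A' A')"
  define tB where "tB = real (rep_moment 3 B' B')"
  have nn: "a \<ge> 0" "b \<ge> 0" "s \<ge> 0" "l \<ge> 8" "eA \<ge> 0" "eB \<ge> 0" "tA \<ge> 0" "tB \<ge> 0"
    unfolding a_def b_def s_def l_def eA_def eB_def tA_def tB_def using L by auto
  have hA: "b ^ 18 * a ^ 3 * eA ^ 9 \<le> l ^ 32 * s ^ 10 * kB ^ 2 * kA * tB ^ 2 * tA ^ 6"
    unfolding a_def b_def s_def l_def eA_def tA_def tB_def
    by (rule energy_half_chain[OF fin' A'(2) B'(2) L(1) le4(1) A'(4) k'(1) kA(2) k'(2) kB(2)])
  have hB: "a ^ 18 * b ^ 3 * eB ^ 9 \<le> l ^ 32 * s ^ 10 * kA ^ 2 * kB * tA ^ 2 * tB ^ 6"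
    using energy_half_chain[OF fin'(2,1) B'(2) A'(2) L(1) le4(2) B'(4) k'(2) kB(2) k'(1) kA(2)]
    unfolding a_def b_def s_def l_def eB_def tA_def tB_def by (simp add: add.commute)
  have "real ((card A' * card B') ^ 4) \<le> real (card (A' + B') ^ 2 * (rep_moment 2 A' A' * rep_moment 2 B' B'))"
    by (rule of_nat_mono[OF energy_product_ge[OF fin']])
  then have en: "(a * b) ^ 4 \<le> s ^ 2 * (eA * eB)"
    unfolding a_def b_def s_def eA_def eB_def by simp
  \<comment> \<open>57 = 21 + 4 * 9: the power 9 matches the additive energies in \<open>hA\<close>
    and \<open>hB\<close>, and 21 = 18 + 3 collects their powers of \<open>a\<close> and
    \<open>b\<close>.\<close>
  have "(a * b) ^ 57 = (a * b) ^ 21 * ((a * b) ^ 4) ^ 9" by (simp flip: power_mult power_add)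
  also have "\<dots> \<le> (a * b) ^ 21 * (s ^ 2 * (eA * eB)) ^ 9"
    using en nn by (intro mult_left_mono power_mono) auto
  also have "\<dots> = s ^ 18 * ((b ^ 18 * a ^ 3 * eA ^ 9) * (a ^ 18 * b ^ 3 * eB ^ 9))"
    by (simp add: power_mult_distrib eval_nat_numeral)
  also have "\<dots> \<le> s ^ 18 * ((l ^ 32 * s ^ 10 * kB ^ 2 * kA * tB ^ 2 * tA ^ 6) * (l ^ 32 * s ^ 10 * kA ^ 2 * kB * tA ^ 2 * tB ^ 6))"
    using nn kA kB by (intro mult_left_mono mult_mono[OF hA hB]) auto
  also have "\<dots> = l ^ 64 * (s ^ 38 * (kA * kB) ^ 3 * (tA * tB) ^ 8)"
    by (simp add: power_mult_distrib eval_nat_numeral)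
  finally have ab: "(a * b) ^ 57 \<le> l ^ 64 * (s ^ 38 * (kA * kB) ^ 3 * (tA * tB) ^ 8)" .
  have two: "real (card A) \<le> 2 * a" "real (card B) \<le> 2 * b"
    using of_nat_mono[OF A'(3), where 'a = real] of_nat_mono[OF B'(3), where 'a = real] by (auto simp: a_def b_def)
  have "(real (card A) * real (card B)) ^ 57 \<le> ((2 * a) * (2 * b)) ^ 57"
    using two nn by (intro power_mono mult_mono) auto
  also have "\<dots> = 4 ^ 57 * (a * b) ^ 57" by (simp flip: power_mult_distrib)
  also have "\<dots> \<le> 4 ^ 57 * (l ^ 64 * (s ^ 38 * (kA * kB) ^ 3 * (tA * tB) ^ 8))"
    using ab by (intro mult_left_mono) auto
  also have "\<dots> \<le> l ^ 38 * (l ^ 64 * (s ^ 38 * (kA * kB) ^ 3 * (tA * tB) ^ 8))"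
  proof (rule mult_right_mono)
    have "(4::real) ^ 57 = 8 ^ 38" by simp
    also have "\<dots> \<le> l ^ 38" using nn by (intro power_mono) auto
    finally show "4 ^ 57 \<le> l ^ 38" .
  qed (use nn kA kB in auto)
  also have "\<dots> = l ^ 102 * (s ^ 38 * (kA * kB) ^ 3 * (tA * tB) ^ 8)"
    by (simp flip: mult.assoc power_add)
  also have "\<dots> \<le> l ^ 102 * (real (card (A + B)) ^ 38 * (kA * kB) ^ 3 * (real (rep_moment 3 A A) * real (rep_moment 3 B B)) ^ 8)"
  proof -
    have "s \<le> real (card (A + B))" unfolding s_def
      using fin A' B' by (intro of_nat_mono card_mono set_plus_mono2) (auto simp: finite_set_plus)
    moreover have "tA \<le> real (rep_moment 3 A A)" "tB \<le> real (rep_moment 3 B B)" unfolding tA_def tB_def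
      using fin A' B' by (auto intro!: of_nat_mono rep_moment_mono)
    ultimately show ?thesis
      using nn kA kB by (intro mult_left_mono mult_mono power_mono mult_nonneg_nonneg) auto
  qed
  finally show ?thesis by (simp add: l_def mult.assoc)
qed

section \<open>Convex functions\<close>

lemma strictly_convex_onD:
  assumes "strictly_convex_on S f" "x \<in> S" "y \<in> S" "z \<in> S" "x \<noteq> y" "0 < t" "t < 1" "(1 - t) * x + t * y = z"
  shows "f z < (1 - t) * f x + t * f y"
  using assms unfolding strictly_convex_on_def by blast

text \<open>Both q and p' lie strictly between p and q', with complementary weights t and 1 - t;
  adding the two chord inequalities gives the claim.\<close>

lemma strictly_convex_increment_less:
  assumes conv: "strictly_convex_on S f" and S: "p \<in> S" "q \<in> S" "p' \<in> S" "q' \<in> S"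
    and ord: "p < q" "p < p'" "q - p = q' - p'"
  shows "f q - f p < f q' - f p'"
proof -
  define D where "D = q' - p"
  define t where "t = (q - p) / D"
  have D: "D > 0" using ord by (simp add: D_def)
  have t: "0 < t" "t < 1" using D ord by (auto simp: t_def D_def)
  have tD: "t * D = q - p" using D by (simp add: t_def)
  have q: "(1 - t) * p + t * q' = q" using tD by (simp add: D_def algebra_simps)
  have p': "(1 - (1 - t)) * p + (1 - t) * q' = p'" using tD ord(3) by (simp add: D_def algebra_simps)
  have ne: "p \<noteq> q'" using D by (auto simp: D_def)
  have "f q < (1 - t) * f p + t * f q'"
    by (rule strictly_convex_onD[OF conv S(1,4,2) ne t q])
  moreover have "f p' < (1 - (1 - t)) * f p + (1 - t) * f q'"
    by (rule strictly_convex_onD[OF conv S(1,4,3) ne _ _ p']) (use t in auto)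
  ultimately show ?thesis by (simp add: algebra_simps)
qed

text \<open>Increments over a fixed length strictly increase with the starting point, so a chord
  vector determines its position on the graph.\<close>

lemma strictly_convex_differences:
  assumes conv: "strictly_convex_on S f" and S: "a \<in> S" "b \<in> S" "a' \<in> S" "b' \<in> S"
    and eq: "a \<noteq> b" "a - b = a' - b'" "f a - f b = f a' - f b'"
  shows "a = a'"
proof -
  have wlog: "x = x'" if "x \<in> S" "y \<in> S" "x' \<in> S" "y' \<in> S" "x < y" "x - y = x' - y'" "f x - f y = f x' - f y'"
    for x y x' y'
    using strictly_convex_increment_less[OF conv, of x y x' y']
      strictly_convex_increment_less[OF conv, of x' y' x y] that
    by (smt (verit))
  show ?thesis
  proof (cases "a < b")
    case True
    then show ?thesis using wlog[of a b a' b'] S eq by blast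
  next
    case False
    then have "b = b'" using wlog[of b a b' a'] S eq by linarith
    then show ?thesis using eq by simp
  qed
qed

definition monotone_curve :: "(real \<Rightarrow> real) \<Rightarrow> real set \<Rightarrow> bool"
  where "monotone_curve f A \<longleftrightarrow>
    increasing_curve (\<lambda>x. x) f A \<or> increasing_curve (\<lambda>x. x) (\<lambda>x. - f x) A"

lemma increasing_curveI:
  assumes mono: "\<And>a b. a \<in> A \<Longrightarrow> b \<in> A \<Longrightarrow> a < b \<Longrightarrow> \<phi> a < \<phi> b"
    and diff: "\<And>a b a' b'. \<lbrakk>a \<in> A; b \<in> A; a' \<in> A; b' \<in> A; a \<noteq> b; a - b = a' - b'; \<phi> a - \<phi> b = \<phi> a' - \<phi> b'\<rbrakk> \<Longrightarrow> a = a'"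
  shows "increasing_curve (\<lambda>x. x) \<phi> A"
proof -
  have iff: "a < b \<longleftrightarrow> \<phi> a < \<phi> b" if "a \<in> A" "b \<in> A" for a b
    using mono[of a b] mono[of b a] that by (cases a b rule: linorder_cases) auto
  have "inj_on \<phi> A" using iff by (intro inj_onI) (metis less_irrefl linorder_neqE_linordered_idom)
  then show ?thesis
    unfolding increasing_curve_def by (intro conjI ballI impI iff) (auto simp: inj_on_def intro: diff)
qed

text \<open>Split at a minimiser. A value between two others lies below the larger of them, so
  \<open>f\<close> increases to the right of the minimiser and decreases to its left; the larger
  side is kept.\<close>

lemma strictly_convex_monotone_piece:
  assumes conv: "strictly_convex_on S f" and A: "A \<subseteq> S" "finite A" "A \<noteq> {}"
  shows "\<exists>A'\<subseteq>A. A' \<noteq> {} \<and> card A \<le> 2 * card A' \<and> monotone_curve f A'"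
proof -
  \<comment> \<open>The largest minimiser: a strictly convex function can attain its minimum over \<open>A\<close> twice.\<close>
  define Mins where "Mins = {a \<in> A. \<forall>x\<in>A. f a \<le> f x}"
  have "Mins \<noteq> {}"
    using ex_is_arg_min_if_finite[OF A(2,3), of f] unfolding is_arg_min_def Mins_def
    by (auto simp: linorder_not_less)
  moreover have finMins: "finite Mins" using A by (simp add: Mins_def)
  ultimately have "Max Mins \<in> Mins" by (intro Max_in)
  define m where "m = Max Mins"
  have m: "m \<in> A" "\<And>a. a \<in> A \<Longrightarrow> f m \<le> f a"
    using \<open>Max Mins \<in> Mins\<close> by (auto simp: m_def Mins_def)
  have m_less: "f m < f b" if "b \<in> A" "m < b" for b
  proof (rule ccontr)
    assume "\<not> f m < f b"
    then have "b \<in> Mins" using m that by (fastforce simp: Mins_def)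
    then show False using Max_ge[OF finMins, of b] that by (simp add: m_def)
  qed
  define R where "R = {a \<in> A. m \<le> a}"
  define Q where "Q = {a \<in> A. a < m}"
  have between: "f y < max (f x) (f z)" if "x \<in> A" "y \<in> A" "z \<in> A" "x < y" "y < z" for x y z
  proof -
    define t where "t = (y - x) / (z - x)"
    have t: "0 < t" "t < 1" using that by (auto simp: t_def)
    have "t * (z - x) = y - x" using that by (simp add: t_def)
    then have y: "(1 - t) * x + t * z = y" by (simp add: algebra_simps)
    have "f y < (1 - t) * f x + t * f z"
      by (rule strictly_convex_onD[OF conv _ _ _ _ t y]) (use that A(1) in auto)
    also have "\<dots> \<le> (1 - t) * max (f x) (f z) + t * max (f x) (f z)"
      using t by (intro add_mono mult_left_mono) auto
    finally show ?thesis by (simp add: algebra_simps)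
  qed
  have incR: "f a < f b" if "a \<in> R" "b \<in> R" "a < b" for a b
  proof (cases "a = m")
    case True
    then show ?thesis using m_less that by (auto simp: R_def)
  next
    case False
    then have "f a < max (f m) (f b)" using between[of m a b] m that by (auto simp: R_def)
    then show ?thesis using m(2)[of b] that by (auto simp: R_def max_def)
  qed
  have decQ: "f b < f a" if "a \<in> Q" "b \<in> Q" "a < b" for a b
  proof -
    have "f b < max (f a) (f m)" using between[of a b m] m that by (auto simp: Q_def)
    then show ?thesis using m(2)[of a] that by (auto simp: Q_def max_def)
  qed
  have sub: "R \<subseteq> A" "Q \<subseteq> A" by (auto simp: R_def Q_def)
  have "monotone_curve f R"
    unfolding monotone_curve_def
  proof (rule disjI1, rule increasing_curveI)
    fix a b a' b' assume "a \<in> R" "b \<in> R" "a' \<in> R" "b' \<in> R" "a \<noteq> b" "a - b = a' - b'"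
      and "f a - f b = f a' - f b'"
    then show "a = a'" using strictly_convex_differences[OF conv, of a b a' b'] sub A(1) by blast
  qed (use incR in auto)
  moreover have "monotone_curve f Q"
    unfolding monotone_curve_def
  proof (rule disjI2, rule increasing_curveI)
    fix a b a' b' assume *: "a \<in> Q" "b \<in> Q" "a' \<in> Q" "b' \<in> Q" "a \<noteq> b" "a - b = a' - b'"
      and "- f a - - f b = - f a' - - f b'"
    then have "f a - f b = f a' - f b'" by linarith
    then show "a = a'" using strictly_convex_differences[OF conv, of a b a' b'] * sub A(1) by blast
  qed (use decQ in auto)
  moreover have "card A = card R + card Q"
  proof -
    have "A = R \<union> Q" "R \<inter> Q = {}" by (auto simp: R_def Q_def)
    then show ?thesis using A(2) by (metis card_Un_disjoint finite_Un)
  qed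
  moreover have "card A > 0" using A by (simp add: card_gt_0_iff)
  ultimately have "(card A \<le> 2 * card R \<and> R \<noteq> {}) \<or> (card A \<le> 2 * card Q \<and> Q \<noteq> {})"
    by (cases "card Q \<le> card R") auto
  then show ?thesis using sub \<open>monotone_curve f R\<close> \<open>monotone_curve f Q\<close> by blast
qed

lemma monotone_curve_uminus: "monotone_curve (\<lambda>x. - f x) A \<longleftrightarrow> monotone_curve f A"
  unfolding monotone_curve_def by auto

lemma convex_or_concave_monotone_piece:
  assumes "strictly_convex_on S f \<or> strictly_concave_on S f" "A \<subseteq> S" "finite A" "A \<noteq> {}"
  obtains A' where "A' \<subseteq> A" "A' \<noteq> {}" "card A \<le> 2 * card A'" "monotone_curve f A'"
proof -
  have "\<exists>A'\<subseteq>A. A' \<noteq> {} \<and> card A \<le> 2 * card A' \<and> monotone_curve f A'"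
    using assms(1)
  proof
    assume "strictly_convex_on S f"
    then show ?thesis by (rule strictly_convex_monotone_piece[OF _ assms(2-4)])
  next
    assume "strictly_concave_on S f"
    then show ?thesis
      using strictly_convex_monotone_piece[of S "\<lambda>x. - f x", OF _ assms(2-4)]
      by (simp add: strictly_concave_on_iff_neg monotone_curve_uminus)
  qed
  then show ?thesis using that by blast
qed

lemma cubic_moment_bound_uminus:
  assumes "cubic_moment_bound k (uminus ` A)"
  shows "cubic_moment_bound k A"
  unfolding cubic_moment_bound_def
proof (intro allI impI)
  fix X :: "real set" assume "finite X"
  then have "real (rep_moment 3 (uminus ` A) (uminus ` X)) \<le> k * real (card (uminus ` X)) ^ 2"
    using assms unfolding cubic_moment_bound_def by blast
  then show "real (rep_moment 3 A X) \<le> k * real (card X) ^ 2" by (simp add: rep_moment_uminus card_image)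
qed

section \<open>Two-sided bounds and assembly of the exponents\<close>

lemma cubic_moment_boundI:
  assumes fin: "finite V" "V \<noteq> {}"
    and le: "\<And>X. finite X \<Longrightarrow> rep_moment 3 A X * rep_moment 3 V V \<le> c * card X ^ 2"
  shows "cubic_moment_bound (real c / real (rep_moment 3 V V)) A"
  unfolding cubic_moment_bound_def
proof (intro allI impI)
  fix X :: "real set" assume "finite X"
  then have "real (rep_moment 3 A X * rep_moment 3 V V) \<le> real (c * card X ^ 2)" using le by (intro of_nat_mono)
  moreover have "real (rep_moment 3 V V) > 0" using rep_moment_pos[OF fin, of 3] by simp
  ultimately show "real (rep_moment 3 A X) \<le> real c / real (rep_moment 3 V V) * real (card X) ^ 2"
    by (simp add: field_simps)
qed

text \<open>\<open>cubic_moment_tradeoff\<close> is applied twice, the second time to the curve with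
  exchanged coordinates on the subset found first. The denominators of \<open>k\<close> and
  \<open>k'\<close> are energies of larger sets, which dominate the energies for \<open>H\<close>
  and thus cancel them; the last bound is the case X = H of the first tradeoff.\<close>

lemma increasing_curve_two_sided_bounds:
  assumes fin: "finite A" "A \<noteq> {}" and curve: "increasing_curve (\<lambda>x. x) f A"
    and L: "L \<ge> 8" "card A ^ 4 \<le> 2 ^ L"
  obtains H k k' where "H \<subseteq> A" "H \<noteq> {}" "card A \<le> L ^ 6 * card H" "inj_on f H"
    "cubic_moment_bound k H" "k \<ge> 0" "cubic_moment_bound k' (f ` H)" "k' \<ge> 0"
    "k * real (rep_moment 3 (f ` H) (f ` H)) \<le> real (L ^ 12 * card A ^ 5)"
    "k' * real (rep_moment 3 H H) \<le> real (L ^ 12 * card A ^ 5)"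
    "real (rep_moment 3 H H) * real (rep_moment 3 (f ` H) (f ` H)) \<le> real (L ^ 12 * card A ^ 7)"
proof -
  obtain H1 M1 where 1: "H1 \<subseteq> M1" "M1 \<subseteq> A" "H1 \<noteq> {}" "card A \<le> L ^ 3 * card H1"
    and m1: "\<forall>X. finite X \<longrightarrow> rep_moment 3 ((\<lambda>x. x) ` H1) X * rep_moment 3 (f ` M1) (f ` M1) \<le> L ^ 12 * card A ^ 5 * card X ^ 2"
    by (rule cubic_moment_tradeoff[OF fin curve L])
  have fin1: "finite H1" "finite M1" "M1 \<noteq> {}" using 1 fin by (auto dest: finite_subset)
  have curve1: "increasing_curve f (\<lambda>x. x) H1"
    using curve 1 increasing_curve_subset increasing_curve_sym by (meson subset_trans)
  have H1A: "H1 \<subseteq> A" using 1 by blast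
  have cH1: "card H1 \<le> card A" using H1A fin by (simp add: card_mono)
  have "card H1 ^ 4 \<le> card A ^ 4" using cH1 by (rule power_mono) simp
  then have L1: "card H1 ^ 4 \<le> 2 ^ L" using L(2) by linarith
  obtain H M2 where 2: "H \<subseteq> M2" "M2 \<subseteq> H1" "H \<noteq> {}" "card H1 \<le> L ^ 3 * card H"
    and m2: "\<forall>X. finite X \<longrightarrow> rep_moment 3 (f ` H) X * rep_moment 3 ((\<lambda>x. x) ` M2) ((\<lambda>x. x) ` M2) \<le> L ^ 12 * card H1 ^ 5 * card X ^ 2"
    by (rule cubic_moment_tradeoff[OF fin1(1) 1(3) curve1 L(1) L1])
  have fin2: "finite M2" "finite H" "M2 \<noteq> {}" using 2 fin1 by (auto dest: finite_subset)
  have HA: "H \<subseteq> A" "H \<subseteq> H1" using 2 H1A by auto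
  define c where "c = L ^ 12 * card A ^ 5"
  have le1: "rep_moment 3 H X * rep_moment 3 (f ` M1) (f ` M1) \<le> c * card X ^ 2" if "finite X" for X
  proof -
    have "rep_moment 3 H X \<le> rep_moment 3 H1 X" using fin1 HA that by (intro rep_moment_mono) auto
    then show ?thesis using m1[rule_format, OF that] unfolding c_def by simp (meson mult_le_mono1 order_trans)
  qed
  have le2: "rep_moment 3 (f ` H) X * rep_moment 3 M2 M2 \<le> c * card X ^ 2" if "finite X" for X
  proof -
    have "L ^ 12 * card H1 ^ 5 * card X ^ 2 \<le> c * card X ^ 2"
      unfolding c_def using cH1 by (intro mult_mono power_mono) auto
    then show ?thesis using m2[rule_format, OF that] unfolding image_ident by linarith
  qed
  have fM1: "finite (f ` M1)" "f ` M1 \<noteq> {}" using fin1 by auto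
  have k1: "cubic_moment_bound (real c / real (rep_moment 3 (f ` M1) (f ` M1))) H"
    by (rule cubic_moment_boundI[OF fM1 le1])
  have k2: "cubic_moment_bound (real c / real (rep_moment 3 M2 M2)) (f ` H)"
    by (rule cubic_moment_boundI[OF fin2(1,3) le2])
  have mfM: "rep_moment 3 (f ` H) (f ` H) \<le> rep_moment 3 (f ` M1) (f ` M1)"
    using fM1 HA(2) 1(1) by (intro rep_moment_mono image_mono) auto
  have mM2: "rep_moment 3 H H \<le> rep_moment 3 M2 M2"
    using fin2 2 by (intro rep_moment_mono) auto
  have div: "real c / real y * real x \<le> real c" if "x \<le> y" "y \<ge> 1" for x y :: nat
  proof -
    have "real c * real x \<le> real c * real y" using that by (intro mult_left_mono) auto
    then show ?thesis using that by (simp add: field_simps)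
  qed
  show ?thesis
  proof (rule that[OF HA(1) 2(3) _ _ k1 _ k2])
    have "card A \<le> L ^ 3 * (L ^ 3 * card H)" using 1(4) 2(4) by (meson mult_le_mono2 order_trans)
    then show "card A \<le> L ^ 6 * card H" by (simp flip: mult.assoc power_add)
    show "inj_on f H" using curve HA unfolding increasing_curve_def by (meson inj_on_subset)
    show "real c / real (rep_moment 3 (f ` M1) (f ` M1)) * real (rep_moment 3 (f ` H) (f ` H)) \<le> real (L ^ 12 * card A ^ 5)"
      unfolding c_def[symmetric] using mfM rep_moment_pos[OF fM1] by (rule div)
    show "real c / real (rep_moment 3 M2 M2) * real (rep_moment 3 H H) \<le> real (L ^ 12 * card A ^ 5)"
      unfolding c_def[symmetric] using mM2 rep_moment_pos[OF fin2(1,3)] by (rule div)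
    have "rep_moment 3 H H * rep_moment 3 (f ` H) (f ` H) \<le> rep_moment 3 H H * rep_moment 3 (f ` M1) (f ` M1)"
      using mfM by simp
    also have "\<dots> \<le> c * card H ^ 2" by (rule le1[OF fin2(2)])
    also have "\<dots> \<le> c * card A ^ 2" using HA fin by (intro mult_left_mono power_mono card_mono) auto
    also have "\<dots> = L ^ 12 * card A ^ 7" by (simp add: c_def mult.assoc flip: power_add)
    finally have "real (rep_moment 3 H H * rep_moment 3 (f ` H) (f ` H)) \<le> real (L ^ 12 * card A ^ 7)" by (rule of_nat_mono)
    then show "real (rep_moment 3 H H) * real (rep_moment 3 (f ` H) (f ` H)) \<le> real (L ^ 12 * card A ^ 7)" by simp
  qed auto
qed

lemma monotone_curve_two_sided_bounds:
  assumes fin: "finite A" "A \<noteq> {}" and curve: "monotone_curve f A"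
    and L: "L \<ge> 8" "card A ^ 4 \<le> 2 ^ L"
  obtains H k k' where "H \<subseteq> A" "H \<noteq> {}" "card A \<le> L ^ 6 * card H" "inj_on f H"
    "cubic_moment_bound k H" "k \<ge> 0" "cubic_moment_bound k' (f ` H)" "k' \<ge> 0"
    "k * real (rep_moment 3 (f ` H) (f ` H)) \<le> real (L ^ 12 * card A ^ 5)"
    "k' * real (rep_moment 3 H H) \<le> real (L ^ 12 * card A ^ 5)"
    "real (rep_moment 3 H H) * real (rep_moment 3 (f ` H) (f ` H)) \<le> real (L ^ 12 * card A ^ 7)"
  using curve unfolding monotone_curve_def
proof
  assume "increasing_curve (\<lambda>x. x) f A"
  then show ?thesis by (rule increasing_curve_two_sided_bounds[OF fin _ L]) (rule that)
next
  assume "increasing_curve (\<lambda>x. x) (\<lambda>x. - f x) A"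
  then show ?thesis
  proof (rule increasing_curve_two_sided_bounds[OF fin _ L], goal_cases)
    case (1 H k k')
    have img: "(\<lambda>x. - f x) ` H = uminus ` f ` H" by (simp add: image_image)
    have "inj_on f H" using 1(4) by (simp add: inj_on_def)
    then show ?case
      using 1 cubic_moment_bound_uminus[of k' "f ` H"] unfolding img rep_moment_uminus by (intro that[of H k k']) auto
  qed
qed

lemma card_set_plus_mono:
  fixes A B :: "real set"
  assumes "finite A" "finite B" "A' \<subseteq> A" "B' \<subseteq> B"
  shows "card (A' + B') \<le> card (A + B)"
  using assms by (intro card_mono set_plus_mono2 finite_set_plus)

text \<open>Regroup as (p e')^3 (p' e)^3 (e e')^5. The exponents are 36 + 36 + 60 = 132 for
  \<open>l\<close> and 15 + 15 + 35 = 65 for \<open>a\<close>.\<close>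

lemma moment_factor_bound:
  fixes p p' e e' l a :: real
  assumes nn: "p \<ge> 0" "p' \<ge> 0" "e \<ge> 0" "e' \<ge> 0" "l \<ge> 0" "a \<ge> 0"
    and le: "p * e' \<le> l ^ 12 * a ^ 5" "p' * e \<le> l ^ 12 * a ^ 5" "e * e' \<le> l ^ 12 * a ^ 7"
  shows "(p * p') ^ 3 * (e * e') ^ 8 \<le> l ^ 132 * a ^ 65"
proof -
  have "(p * p') ^ 3 * (e * e') ^ 8 = (p * e') ^ 3 * (p' * e) ^ 3 * (e * e') ^ 5"
    by (simp add: power_mult_distrib eval_nat_numeral)
  also have "\<dots> \<le> (l ^ 12 * a ^ 5) ^ 3 * (l ^ 12 * a ^ 5) ^ 3 * (l ^ 12 * a ^ 7) ^ 5"
    using nn by (intro mult_mono[OF mult_mono] power_mono le) auto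
  also have "\<dots> = (l ^ 36 * l ^ 36 * l ^ 60) * (a ^ 15 * a ^ 15 * a ^ 35)"
    by (simp add: power_mult_distrib mult_ac flip: power_mult)
  also have "\<dots> = l ^ 132 * a ^ 65" by (simp flip: power_add)
  finally show ?thesis .
qed

lemma sumset_product_monotone:
  fixes A B :: "real set"
  assumes fin: "finite A" "finite B" and ne: "A \<noteq> {}" "B \<noteq> {}"
    and curve: "monotone_curve f A" "monotone_curve g B"
    and L: "L \<ge> 8" "card A ^ 4 \<le> 2 ^ L" "card B ^ 4 \<le> 2 ^ L"
  shows "(real (card A) * real (card B)) ^ 49
    \<le> real L ^ 1836 * (real (card (A + B)) * real (card (f ` A + g ` B))) ^ 38"
proof -
  obtain H p p' where H: "H \<subseteq> A" "H \<noteq> {}" "card A \<le> L ^ 6 * card H" "inj_on f H"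
    and p: "cubic_moment_bound p H" "p \<ge> 0" "cubic_moment_bound p' (f ` H)" "p' \<ge> 0"
    and leA: "p * real (rep_moment 3 (f ` H) (f ` H)) \<le> real (L ^ 12 * card A ^ 5)"
      "p' * real (rep_moment 3 H H) \<le> real (L ^ 12 * card A ^ 5)"
      "real (rep_moment 3 H H) * real (rep_moment 3 (f ` H) (f ` H)) \<le> real (L ^ 12 * card A ^ 7)"
    by (rule monotone_curve_two_sided_bounds[OF fin(1) ne(1) curve(1) L(1,2)])
  obtain K q q' where K: "K \<subseteq> B" "K \<noteq> {}" "card B \<le> L ^ 6 * card K" "inj_on g K"
    and q: "cubic_moment_bound q K" "q \<ge> 0" "cubic_moment_bound q' (g ` K)" "q' \<ge> 0"
    and leB: "q * real (rep_moment 3 (g ` K) (g ` K)) \<le> real (L ^ 12 * card B ^ 5)"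
      "q' * real (rep_moment 3 K K) \<le> real (L ^ 12 * card B ^ 5)"
      "real (rep_moment 3 K K) * real (rep_moment 3 (g ` K) (g ` K)) \<le> real (L ^ 12 * card B ^ 7)"
    by (rule monotone_curve_two_sided_bounds[OF fin(2) ne(2) curve(2) L(1,3)])
  define a b h k l where abhkl: "a = real (card A)" "b = real (card B)" "h = real (card H)"
    "k = real (card K)" "l = real L"
  define s t s' t' where st: "s = real (card (H + K))" "t = real (card (f ` H + g ` K))"
    "s' = real (card (A + B))" "t' = real (card (f ` A + g ` B))"
  define e1 e2 e3 e4 where e: "e1 = real (rep_moment 3 H H)" "e2 = real (rep_moment 3 (f ` H) (f ` H))"
    "e3 = real (rep_moment 3 K K)" "e4 = real (rep_moment 3 (g ` K) (g ` K))"
  have fin': "finite H" "finite K" using H K fin finite_subset by auto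
  have nn: "a > 0" "b > 0" "h \<ge> 0" "k \<ge> 0" "l \<ge> 8" "s \<ge> 0" "t \<ge> 0" "s' \<ge> 0" "t' \<ge> 0"
    "e1 \<ge> 0" "e2 \<ge> 0" "e3 \<ge> 0" "e4 \<ge> 0"
    unfolding abhkl st e using fin ne L by (auto simp: card_gt_0_iff)
  have cards: "card (f ` H) = card H" "card (g ` K) = card K" using H K by (auto simp: card_image)
  have le4: "card H ^ 4 \<le> 2 ^ L" "card K ^ 4 \<le> 2 ^ L"
  proof -
    have "card H ^ 4 \<le> card A ^ 4" "card K ^ 4 \<le> card B ^ 4"
      using fin H K by (auto intro!: power_mono card_mono)
    then show "card H ^ 4 \<le> 2 ^ L" "card K ^ 4 \<le> 2 ^ L" using L(2,3) by linarith+
  qed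
  have c1: "(h * k) ^ 57 \<le> l ^ 102 * s ^ 38 * (p * q) ^ 3 * (e1 * e3) ^ 8"
    unfolding abhkl st e
    by (rule energy_chain[OF fin' H(2) K(2) L(1) le4 p(1,2) q(1,2)])
  have c2: "(h * k) ^ 57 \<le> l ^ 102 * t ^ 38 * (p' * q') ^ 3 * (e2 * e4) ^ 8"
    using energy_chain[of "f ` H" "g ` K" L p' q'] fin' H(2) K(2) L(1) le4 p(3,4) q(3,4)
    unfolding abhkl st e cards by simp
  have bA: "(p * p') ^ 3 * (e1 * e2) ^ 8 \<le> l ^ 132 * a ^ 65"
    using leA p nn by (intro moment_factor_bound) (auto simp: abhkl e)
  have bB: "(q * q') ^ 3 * (e3 * e4) ^ 8 \<le> l ^ 132 * b ^ 65"
    using leB q nn by (intro moment_factor_bound) (auto simp: abhkl e)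
  have sub: "s \<le> s'" "t \<le> t'"
    unfolding st using fin H(1) K(1)
    by (auto intro!: card_set_plus_mono)
  have "(h * k) ^ 114 = (h * k) ^ 57 * (h * k) ^ 57" by (simp flip: power_add)
  also have "\<dots> \<le> (l ^ 102 * s ^ 38 * (p * q) ^ 3 * (e1 * e3) ^ 8) * (l ^ 102 * t ^ 38 * (p' * q') ^ 3 * (e2 * e4) ^ 8)"
    using nn p q by (intro mult_mono[OF c1 c2]) auto
  \<comment> \<open>Sorting by origin separates the unknowns of \<open>A\<close> from those of
    \<open>B\<close>, so each group is bounded by \<open>moment_factor_bound\<close>.\<close>
  also have "\<dots> = (l ^ 102 * l ^ 102) * (s * t) ^ 38 * (((p * p') ^ 3 * (e1 * e2) ^ 8) * ((q * q') ^ 3 * (e3 * e4) ^ 8))"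
    unfolding power_mult_distrib by (simp only: mult_ac)
  also have "\<dots> \<le> (l ^ 102 * l ^ 102) * (s' * t') ^ 38 * ((l ^ 132 * a ^ 65) * (l ^ 132 * b ^ 65))"
    using nn p q sub
    by (intro mult_mono[OF mult_left_mono mult_mono[OF bA bB]] power_mono mult_mono[OF sub]) auto
  also have "\<dots> = (l ^ 102 * l ^ 102 * l ^ 132 * l ^ 132) * (s' * t') ^ 38 * (a * b) ^ 65"
    unfolding power_mult_distrib by (simp only: mult_ac)
  also have "l ^ 102 * l ^ 102 * l ^ 132 * l ^ 132 = l ^ 468" by (simp flip: power_add)
  finally have hk: "(h * k) ^ 114 \<le> l ^ 468 * (s' * t') ^ 38 * (a * b) ^ 65" .
  have "a \<le> l ^ 6 * h" "b \<le> l ^ 6 * k"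
    using of_nat_mono[OF H(3), where 'a = real] of_nat_mono[OF K(3), where 'a = real] by (auto simp: abhkl)
  then have "a * b \<le> (l ^ 6 * h) * (l ^ 6 * k)" using nn by (intro mult_mono) auto
  also have "\<dots> = (l ^ 6 * l ^ 6) * (h * k)" by (simp only: mult_ac)
  also have "l ^ 6 * l ^ 6 = l ^ 12" by (simp flip: power_add)
  finally have "(a * b) ^ 114 \<le> (l ^ 12 * (h * k)) ^ 114" using nn by (intro power_mono) auto
  also have "\<dots> = l ^ 1368 * (h * k) ^ 114" by (simp add: power_mult_distrib[of "l ^ 12"] flip: power_mult)
  also have "\<dots> \<le> l ^ 1368 * (l ^ 468 * (s' * t') ^ 38 * (a * b) ^ 65)"
    using hk nn by (intro mult_left_mono) auto
  also have "\<dots> = (l ^ 1368 * l ^ 468) * (s' * t') ^ 38 * (a * b) ^ 65" by (simp only: mult_ac)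
  also have "l ^ 1368 * l ^ 468 = l ^ 1836" by (simp flip: power_add)
  \<comment> \<open>114 - 65 = 49. The logarithmic exponent is 12 * 114 + 2 * 102 + 2 * 132 = 1836,
    the first term being the loss in passing from \<open>H\<close>, \<open>K\<close> back to
    \<open>A\<close>, \<open>B\<close>.\<close>
  finally have "(a * b) ^ 49 * (a * b) ^ 65 \<le> (l ^ 1836 * (s' * t') ^ 38) * (a * b) ^ 65"
    by (simp flip: power_add)
  moreover have "(a * b) ^ 65 > 0" using nn by (intro zero_less_power mult_pos_pos)
  ultimately have "(a * b) ^ 49 \<le> l ^ 1836 * (s' * t') ^ 38" by (rule mult_right_le_imp_le)
  then show ?thesis by (simp add: abhkl st)
qed

text \<open>The summand 8 and the rounding cost at most 9 \<le> 9 log_2 N, whence 13 log_2 N; ln 2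
  \<ge> 1/2 doubles this to 26 ln N.\<close>

lemma exists_dyadic_length:
  assumes "N \<ge> (2::nat)"
  obtains L where "L \<ge> 8" "N ^ 4 \<le> 2 ^ L" "real L \<le> 26 * ln (real N)"
proof -
  define L where "L = nat \<lceil>4 * log 2 (real N)\<rceil> + 8"
  have lg: "log 2 (real N) \<ge> 1" using assms by (simp add: le_log_iff)
  have up: "real L \<le> 4 * log 2 (real N) + 9" and lo: "4 * log 2 (real N) \<le> real L"
    using lg unfolding L_def by linarith+
  have "real (N ^ 4) = real N powr 4" using assms by simp
  also have "\<dots> = (2 powr log 2 (real N)) powr 4" using assms by simp
  also have "\<dots> = 2 powr (4 * log 2 (real N))" by (simp add: powr_powr mult.commute)
  also have "\<dots> \<le> 2 powr real L" using lo by (intro powr_mono) auto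
  also have "\<dots> = real (2 ^ L)" by (simp add: powr_realpow)
  finally have "N ^ 4 \<le> 2 ^ L" by (simp only: of_nat_le_iff)
  moreover have "real L \<le> 26 * ln (real N)"
  proof -
    have "real L \<le> 13 * log 2 (real N)" using up lg by linarith
    also have "log 2 (real N) = ln (real N) / ln 2" by (simp add: log_def)
    also have "\<dots> \<le> ln (real N) / (1 / 2)"
      using assms ln2_ge_two_thirds by (intro divide_left_mono) auto
    finally show ?thesis by simp
  qed
  ultimately show ?thesis using that[of L] by (simp add: L_def)
qed

lemma sumset_product_bound:
  fixes A B :: "real set"
  assumes fin: "finite A" "finite B" and ST: "A \<subseteq> S" "B \<subseteq> T"
    and f: "strictly_convex_on S f \<or> strictly_concave_on S f"
    and g: "strictly_convex_on T g \<or> strictly_concave_on T g"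
  shows "(real (card A) * real (card B)) ^ 49
    \<le> 4 ^ 49 * (26 * ln (real (size_param A B))) ^ 1836 * (real (card (A + B)) * real (card (f ` A + g ` B))) ^ 38"
proof (cases "A = {} \<or> B = {}")
  case True
  then have "(real (card A) * real (card B)) ^ 49 = 0" by auto
  also have "0 \<le> 4 ^ 49 * (26 * ln (real (size_param A B))) ^ 1836 * (real (card (A + B)) * real (card (f ` A + g ` B))) ^ 38"
    by (intro mult_nonneg_nonneg zero_le_power ln_ge_zero) (simp_all add: size_param_def)
  finally show ?thesis .
next
  case False
  then have ne: "A \<noteq> {}" "B \<noteq> {}" by auto
  define N where "N = size_param A B"
  have N: "N \<ge> 2" "card A \<le> N" "card B \<le> N" by (auto simp: N_def size_param_def)
  obtain L where L: "L \<ge> 8" "N ^ 4 \<le> 2 ^ L" "real L \<le> 26 * ln (real N)"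
    by (rule exists_dyadic_length[OF N(1)])
  obtain A' where A': "A' \<subseteq> A" "A' \<noteq> {}" "card A \<le> 2 * card A'" "monotone_curve f A'"
    by (rule convex_or_concave_monotone_piece[OF f ST(1) fin(1) ne(1)])
  obtain B' where B': "B' \<subseteq> B" "B' \<noteq> {}" "card B \<le> 2 * card B'" "monotone_curve g B'"
    by (rule convex_or_concave_monotone_piece[OF g ST(2) fin(2) ne(2)])
  have fin': "finite A'" "finite B'" using A' B' fin finite_subset by auto
  have "card A' \<le> N" "card B' \<le> N"
    using card_mono[OF fin(1) A'(1)] card_mono[OF fin(2) B'(1)] N by linarith+
  then have "card A' ^ 4 \<le> N ^ 4" "card B' ^ 4 \<le> N ^ 4" by (auto intro: power_mono)
  then have le4: "card A' ^ 4 \<le> 2 ^ L" "card B' ^ 4 \<le> 2 ^ L" using L(2) by linarith+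
  \<comment> \<open>Each monotone piece contains at least half of its set, which costs 4^49 in
    total.\<close>
  have "(real (card A) * real (card B)) ^ 49 \<le> (real (2 * card A') * real (2 * card B')) ^ 49"
    using A'(3) B'(3) by (intro power_mono mult_mono of_nat_mono) auto
  also have "real (2 * card A') * real (2 * card B') = 4 * (real (card A') * real (card B'))" by simp
  also have "(4 * (real (card A') * real (card B'))) ^ 49 = 4 ^ 49 * (real (card A') * real (card B')) ^ 49"
    by (rule power_mult_distrib)
  also have "\<dots> \<le> 4 ^ 49 * (real L ^ 1836 * (real (card (A' + B')) * real (card (f ` A' + g ` B'))) ^ 38)"
    by (rule mult_left_mono[OF sumset_product_monotone[OF fin' A'(2) B'(2) A'(4) B'(4) L(1) le4]]) simp
  also have "\<dots> \<le> 4 ^ 49 * ((26 * ln (real N)) ^ 1836 * (real (card (A + B)) * real (card (f ` A + g ` B))) ^ 38)"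
  proof -
    have "card (A' + B') \<le> card (A + B)" "card (f ` A' + g ` B') \<le> card (f ` A + g ` B)"
      using fin A'(1) B'(1) by (auto intro!: card_set_plus_mono)
    then have "real (card (A' + B')) * real (card (f ` A' + g ` B')) \<le> real (card (A + B)) * real (card (f ` A + g ` B))"
      by (intro mult_mono of_nat_mono) auto
    moreover have "0 \<le> 26 * ln (real N)" using N(1) by simp
    ultimately show ?thesis
      by (intro mult_left_mono[OF mult_mono[OF power_mono[OF L(3)] power_mono]] zero_le_power) simp_all
  qed
  finally show ?thesis by (simp only: N_def mult.assoc)
qed

theorem theorem6:
  shows "\<exists>c C :: real. c > 0 \<and> C > 0 \<and>
    (\<forall>(A :: real set) (B :: real set) (S :: real set) (T :: real set)
      (f :: real \<Rightarrow> real) (g :: real \<Rightarrow> real).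
      finite A \<longrightarrow> finite B \<longrightarrow> A \<subseteq> S \<longrightarrow> B \<subseteq> T \<longrightarrow>
      strictly_convex_on S f \<or> strictly_concave_on S f \<longrightarrow>
      strictly_convex_on T g \<or> strictly_concave_on T g \<longrightarrow>
      real (card (A + B)) ^ 38 * real (card (f ` A + g ` B)) ^ 38
        \<ge> c * (real (card A) * real (card B)) ^ 49 / ln (real (size_param A B)) powr C)"
proof -
  define c0 :: real where "c0 = 4 ^ 49 * 26 ^ 1836"
  have c0: "c0 > 0" unfolding c0_def by (intro mult_pos_pos zero_less_power) simp_all
  show ?thesis
  proof (intro exI conjI allI impI)
    show "1 / c0 > 0" using c0 by simp
    show "(1836::real) > 0" by simp
    fix A B S T :: "real set" and f g :: "real \<Rightarrow> real"
    assume "finite A" "finite B" "A \<subseteq> S" "B \<subseteq> T"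
      "strictly_convex_on S f \<or> strictly_concave_on S f" "strictly_convex_on T g \<or> strictly_concave_on T g"
    note bound = sumset_product_bound[OF this]
    define l where "l = ln (real (size_param A B))"
    define X where "X = real (card (A + B)) ^ 38 * real (card (f ` A + g ` B)) ^ 38"
    have l: "l > 0" unfolding l_def by (simp add: size_param_def)
    have "(real (card A) * real (card B)) ^ 49 \<le> 4 ^ 49 * (26 ^ 1836 * l ^ 1836) * X"
      using bound unfolding l_def X_def power_mult_distrib .
    then have le: "(real (card A) * real (card B)) ^ 49 \<le> c0 * l ^ 1836 * X"
      unfolding c0_def by (simp only: mult.assoc)
    have lp: "l powr 1836 = l ^ 1836"
      using powr_realpow[OF l, of 1836] by simp
    have "1 / c0 * (real (card A) * real (card B)) ^ 49 / l ^ 1836 \<le> 1 / c0 * (c0 * l ^ 1836 * X) / l ^ 1836"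
      using le c0 l by (intro divide_right_mono mult_left_mono) auto
    also have "\<dots> = X" using c0 l by simp
    finally show "real (card (A + B)) ^ 38 * real (card (f ` A + g ` B)) ^ 38
        \<ge> 1 / c0 * (real (card A) * real (card B)) ^ 49 / ln (real (size_param A B)) powr 1836"
      unfolding X_def l_def[symmetric] lp .
  qed
qed

end
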